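(* Let $G$ be a discrete, torsion-free, non-elementary subgroup of ${\rm Sp}(2,1)$. Let $g$ be a loxodromic element of $G$ with axis $\gamma$ having the form $g={\rm diag}(\lambda_1,\lambda_2,\overline{\lambda}_2^{-1})$, with $\lambda_1,\lambda_2\in\mathbb H$, $|\lambda_1|=1$ and $|\lambda_2|>1$. Suppose that $l=2\log|\lambda_2|<0.00017681$. Let $r$ be the positive number defined by $$\cosh(2r)=\frac{2(1-R)}{R^2},$$ where $$R=2\sqrt{\left(\cosh\frac{1849\,l}{2}+1\right)\left(\cosh\frac{1849\,l}{2}-\cos\frac{2\pi}{43}\right)}+2\sqrt{2\left(1-\cos\frac{2\pi}{43}\right)}.$$ Then the tube $T_r(\gamma)$ is precisely invariant under $\langle g\rangle$ in $G$.
   Context: Let $\mathbb H$ be the quaternions and $\mathbb H^{2,1}$ the right quaternionic vector space of column vectors with $3$ quaternionic entries, with the Hermitian form $\langle {\bf z},{\bf w}\rangle=\overline{w}_1z_1-(\overline{w}_2z_3+\overline{w}_3z_2)$. ${\rm Sp}(2,1)$ is the group of linear automorphisms (matrices acting on the left) preserving this form. Let $V_0=\{{\bf z}\ne 0:\langle {\bf z},{\bf z}\rangle=0\}$, $V_-=\{{\bf z}:\langle {\bf z},{\bf z}\rangle<0\}$, and let $\mathbb P$ be the right projection ${\bf z}\mapsto[{\bf z}]$, where ${\bf z}\sim{\bf z}\lambda$ for $\lambda\in\mathbb H\setminus\{0\}$. Quaternionic hyperbolic space is ${\bf H}^2_{\mathbb H}=\mathbb P(V_-)$, with boundary $\partial{\bf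 H}^2_{\mathbb H}=\mathbb P(V_0)$ and Bergman metric $\rho$ given by $\cosh^2\frac{\rho(z,w)}{2}=\frac{\langle{\bf z},{\bf w}\rangle\langle{\bf w},{\bf z}\rangle}{\langle{\bf z},{\bf z}\rangle\langle{\bf w},{\bf w}\rangle}$ for any lifts ${\bf z},{\bf w}$ of $z,w$; ${\rm Sp}(2,1)$ acts by isometries. An element of ${\rm Sp}(2,1)$ is loxodromic if it has exactly two fixed points in ${\bf H}^2_{\mathbb H}\cup\partial{\bf H}^2_{\mathbb H}$, and both lie in $\partial{\bf H}^2_{\mathbb H}$; its axis is the geodesic joining them. A subgroup of ${\rm Sp}(2,1)$ is elementary if it has a finite orbit in ${\bf H}^2_{\mathbb H}\cup\partial{\bf H}^2_{\mathbb H}$. For a geodesic $\gamma$ and $r>0$, the tube $T_r(\gamma)$ is the set of points of ${\bf H}^2_{\mathbb H}$ at distance less than $r$ from $\gamma$. If $\gamma$ is the axis of $g\in G$, then $T_r(\gamma)$ is called precisely invariant under the subgroup $\langle g\rangle$ of $G$ if $h(T_r(\gamma))\cap T_r(\gamma)=\emptyset$ for all $h\in G\setminus\langle g\rangle$.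
   Formalization: The formal theorem also assumes that g is primitive in G, i.e. g is not f^n with f in G and n ≥ 2; otherwise f lies outside ⟨g⟩ yet maps the tube onto itself, so the claim as stated fails (e.g. g = f²). *)

theory Defs
  imports "HOL-Analysis.Analysis" "HOL-Algebra.Generated_Groups"
begin

section \<open>Quaternions\<close>

datatype quat = Quat (qre: real) (qi: real) (qj: real) (qk: real)

lemma quat_eq_iff: "x = y \<longleftrightarrow> qre x = qre y \<and> qi x = qi y \<and> qj x = qj y \<and> qk x = qk y"
  by (cases x; cases y) simp

instantiation quat :: real_vector
begin

definition "0 = Quat 0 0 0 0"
definition "x + y = Quat (qre x + qre y) (qi x + qi y) (qj x + qj y) (qk x + qk y)"
definition "- x = Quat (- qre x) (- qi x) (- qj x) (- qk x)"
definition "x - y = Quat (qre x - qre y) (qi x - qi y) (qj x - qj y) (qk x - qk y)"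
definition "c *\<^sub>R x = Quat (c * qre x) (c * qi x) (c * qj x) (c * qk x)"

instance
  by standard
    (simp_all add: zero_quat_def plus_quat_def uminus_quat_def minus_quat_def scaleR_quat_def
      algebra_simps)

end

instantiation quat :: real_algebra_1
begin

definition "1 = Quat 1 0 0 0"
definition "x * y = Quat
  (qre x * qre y - qi x * qi y - qj x * qj y - qk x * qk y)
  (qre x * qi y + qi x * qre y + qj x * qk y - qk x * qj y)
  (qre x * qj y - qi x * qk y + qj x * qre y + qk x * qi y)
  (qre x * qk y + qi x * qj y - qj x * qi y + qk x * qre y)"

instance
  by standard
    (simp_all add: zero_quat_def plus_quat_def scaleR_quat_def one_quat_def times_quat_def
      algebra_simps)

end

definition qcnj :: "quat \<Rightarrow> quat" where
  "qcnj x = Quat (qre x) (- qi x) (- qj x) (- qk x)"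

instantiation quat :: real_inner
begin

definition "x \<bullet> y = qre x * qre y + qi x * qi y + qj x * qj y + qk x * qk y"
definition "norm x = sqrt ((qre x)\<^sup>2 + (qi x)\<^sup>2 + (qj x)\<^sup>2 + (qk x)\<^sup>2)"
definition "sgn (x :: quat) = x /\<^sub>R norm x"
definition "dist x y = norm (x - y :: quat)"
definition "(uniformity :: (quat \<times> quat) filter) = (INF e\<in>{0<..}. principal {(x, y). dist x y < e})"
definition "open (U :: quat set) \<longleftrightarrow>
  (\<forall>x\<in>U. eventually (\<lambda>(x', y). x' = x \<longrightarrow> y \<in> U) uniformity)"

instance
proof
  fix x y z :: quat and r :: real
  show "(x + y) \<bullet> z = x \<bullet> z + y \<bullet> z" and "(r *\<^sub>R x) \<bullet> y = r * (x \<bullet> y)" and "x \<bullet> y = y \<bullet> x"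
    by (simp_all add: inner_quat_def plus_quat_def scaleR_quat_def algebra_simps)
  show "0 \<le> x \<bullet> x"
    by (simp add: inner_quat_def)
  show "x \<bullet> x = 0 \<longleftrightarrow> x = 0"
    by (simp add: inner_quat_def quat_eq_iff zero_quat_def add_nonneg_eq_0_iff)
  show "norm x = sqrt (x \<bullet> x)"
    by (simp add: inner_quat_def norm_quat_def power2_eq_square)
qed (simp_all add: sgn_quat_def dist_quat_def uniformity_quat_def open_quat_def)

end

instantiation quat :: real_normed_div_algebra
begin

definition "inverse x = qcnj x /\<^sub>R (norm x)\<^sup>2"
definition "x div (y :: quat) = x * inverse y"

instance
proof
  fix x y :: quat
  have sq: "(norm x)\<^sup>2 = (qre x)\<^sup>2 + (qi x)\<^sup>2 + (qj x)\<^sup>2 + (qk x)\<^sup>2" for x :: quat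
    by (simp add: norm_quat_def)
  have cn: "qcnj x * x = (norm x)\<^sup>2 *\<^sub>R 1" "x * qcnj x = (norm x)\<^sup>2 *\<^sub>R 1" for x :: quat
    unfolding sq
    by (simp_all add: qcnj_def times_quat_def one_quat_def scaleR_quat_def power2_eq_square)
  show "inverse x * x = 1" "x * inverse x = 1" if "x \<noteq> 0"
    using that by (simp_all add: inverse_quat_def cn)
  show "x div y = x * inverse y"
    by (rule divide_quat_def)
  show "inverse (0 :: quat) = 0"
    by (simp add: inverse_quat_def)
  have "(norm (x * y))\<^sup>2 = (norm x * norm y)\<^sup>2"
    unfolding power_mult_distrib sq by (simp add: times_quat_def power2_eq_square algebra_simps)
  then show "norm (x * y) = norm x * norm y"
    by (simp add: power2_eq_iff_nonneg)
qed

end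


section \<open>The Hermitian form and the group Sp(2,1)\<close>

definition herm :: "quat^3 \<Rightarrow> quat^3 \<Rightarrow> quat" where
  "herm z w = qcnj (w $ 1) * z $ 1 - (qcnj (w $ 2) * z $ 3 + qcnj (w $ 3) * z $ 2)"

definition Sp21_set :: "(quat^3^3) set" where
  "Sp21_set = {A. invertible A \<and> (\<forall>z w. herm (A *v z) (A *v w) = herm z w)}"

definition Sp21 :: "(quat^3^3) monoid" where
  "Sp21 = \<lparr>carrier = Sp21_set, monoid.mult = (**), one = mat 1\<rparr>"

lemma group_Sp21: "group Sp21"
proof (rule groupI)
  fix A B C assume A: "A \<in> carrier Sp21" and B: "B \<in> carrier Sp21" and "C \<in> carrier Sp21"
  show "A \<otimes>\<^bsub>Sp21\<^esub> B \<in> carrier Sp21"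
    using A B
    by (auto simp: Sp21_def Sp21_set_def invertible_mult simp flip: matrix_vector_mul_assoc)
  show "A \<otimes>\<^bsub>Sp21\<^esub> B \<otimes>\<^bsub>Sp21\<^esub> C = A \<otimes>\<^bsub>Sp21\<^esub> (B \<otimes>\<^bsub>Sp21\<^esub> C)"
    by (simp add: Sp21_def matrix_mul_assoc)
next
  fix A assume A: "A \<in> carrier Sp21"
  then obtain B where B: "A ** B = mat 1" "B ** A = mat 1"
    by (auto simp: Sp21_def Sp21_set_def invertible_def)
  have "herm (B *v z) (B *v w) = herm z w" for z w
  proof -
    have "herm (A *v (B *v z)) (A *v (B *v w)) = herm (B *v z) (B *v w)"
      using A by (simp add: Sp21_def Sp21_set_def)
    then show ?thesis
      by (simp add: matrix_vector_mul_assoc B)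
  qed
  then show "\<exists>B\<in>carrier Sp21. B \<otimes>\<^bsub>Sp21\<^esub> A = \<one>\<^bsub>Sp21\<^esub>"
    using B by (auto simp: Sp21_def Sp21_set_def invertible_def)
qed (auto simp: Sp21_def Sp21_set_def invertible_def)

definition diag3 :: "quat \<Rightarrow> quat \<Rightarrow> quat \<Rightarrow> quat^3^3" where
  "diag3 a b c = (\<chi> i j. if i = j then vector [a, b, c] $ i else 0)"


section \<open>Quaternionic hyperbolic space\<close>

(* herm z z is always real, so its sign is that of its real part. *)
definition V_neg :: "(quat^3) set" where
  "V_neg = {z. qre (herm z z) < 0}"

definition V_null :: "(quat^3) set" where
  "V_null = {z. z \<noteq> 0 \<and> herm z z = 0}"

(* A projective point is the set of all its lifts. *)
definition proj :: "quat^3 \<Rightarrow> (quat^3) set" where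
  "proj z = {(\<chi> i. z $ i * q) |q. q \<noteq> 0}"

definition hyp_space :: "(quat^3) set set" where
  "hyp_space = proj ` V_neg"

definition hyp_boundary :: "(quat^3) set set" where
  "hyp_boundary = proj ` V_null"

definition act :: "quat^3^3 \<Rightarrow> (quat^3) set \<Rightarrow> (quat^3) set" where
  "act A p = (\<lambda>z. A *v z) ` p"

definition rho :: "(quat^3) set \<Rightarrow> (quat^3) set \<Rightarrow> real" where
  "rho p q = (THE d. d \<ge> 0 \<and> (\<forall>z\<in>p. \<forall>w\<in>q.
     of_real ((cosh (d / 2))\<^sup>2) = (herm z w * herm w z) / (herm z z * herm w w)))"

(* Convergence in projective space: some family of lifts converges to a lift of the limit. *)
definition proj_tendsto :: "('b \<Rightarrow> (quat^3) set) \<Rightarrow> (quat^3) set \<Rightarrow> 'b filter \<Rightarrow> bool" where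
  "proj_tendsto c p F \<longleftrightarrow>
     (\<exists>Z z. (\<forall>t. Z t \<in> c t) \<and> z \<in> p \<and> (Z \<longlongrightarrow> z) F)"

definition geodesic_joining :: "(quat^3) set \<Rightarrow> (quat^3) set \<Rightarrow> (quat^3) set set \<Rightarrow> bool" where
  "geodesic_joining p q \<gamma> \<longleftrightarrow>
     (\<exists>c :: real \<Rightarrow> (quat^3) set. range c = \<gamma> \<and> \<gamma> \<subseteq> hyp_space \<and>
        (\<forall>s t. rho (c s) (c t) = \<bar>s - t\<bar>) \<and>
        proj_tendsto c p at_bot \<and> proj_tendsto c q at_top)"

definition tube :: "real \<Rightarrow> (quat^3) set set \<Rightarrow> (quat^3) set set" where
  "tube r \<gamma> = {x \<in> hyp_space. (INF y\<in>\<gamma>. rho x y) < r}"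


section \<open>Isometries and groups of isometries\<close>

definition fixed_points :: "quat^3^3 \<Rightarrow> (quat^3) set set" where
  "fixed_points A = {p \<in> hyp_space \<union> hyp_boundary. act A p = p}"

definition loxodromic :: "quat^3^3 \<Rightarrow> bool" where
  "loxodromic A \<longleftrightarrow> A \<in> carrier Sp21 \<and> card (fixed_points A) = 2 \<and> fixed_points A \<subseteq> hyp_boundary"

definition is_axis :: "quat^3^3 \<Rightarrow> (quat^3) set set \<Rightarrow> bool" where
  "is_axis A \<gamma> \<longleftrightarrow> loxodromic A \<and>
     (\<exists>p q. fixed_points A = {p, q} \<and> p \<noteq> q \<and> geodesic_joining p q \<gamma>)"

definition elementary :: "(quat^3^3) set \<Rightarrow> bool" where
  "elementary G \<longleftrightarrow> (\<exists>p \<in> hyp_space \<union> hyp_boundary. finite ((\<lambda>h. act h p) ` G))"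

definition torsion_free :: "(quat^3^3) set \<Rightarrow> bool" where
  "torsion_free G \<longleftrightarrow>
     (\<forall>h\<in>G. \<forall>n::nat. n > 0 \<longrightarrow> h [^]\<^bsub>Sp21\<^esub> n = \<one>\<^bsub>Sp21\<^esub> \<longrightarrow> h = \<one>\<^bsub>Sp21\<^esub>)"

(* precisely_invariant cannot hold for G, the cyclic group of g and a tube about the axis of g
   unless g is primitive in G: if g is the n-th power of f in G with n > 1, then f lies outside the
   cyclic group of g (for G torsion-free) but maps the axis of g, hence every tube about it, onto
   itself. *)
definition primitive_in :: "(quat^3^3) set \<Rightarrow> quat^3^3 \<Rightarrow> bool" where
  "primitive_in G g \<longleftrightarrow> \<not> (\<exists>f\<in>G. \<exists>n::nat. n \<ge> 2 \<and> f [^]\<^bsub>Sp21\<^esub> n = g)"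

definition precisely_invariant ::
  "(quat^3^3) set \<Rightarrow> (quat^3^3) set \<Rightarrow> (quat^3) set set \<Rightarrow> bool" where
  "precisely_invariant G H T \<longleftrightarrow> (\<forall>h \<in> G - H. act h ` T \<inter> T = {})"

end

theory Submission
  imports Defs
begin

text \<open>
  By the pigeonhole principle some power \<open>f = g\<^sup>n\<close> with \<open>1 \<le> n \<le> 43\<^sup>2\<close> has both rotation angles within
  \<open>2\<pi>/43\<close> of multiples of \<open>2\<pi>\<close>, so that \<open>M = 2|\<mu>\<^sub>1 - 1| + |\<mu>\<^sub>2 - 1| + |\<mu>\<^sub>3 - 1|\<close> is at most \<open>R\<close>, where
  \<open>f = diag (\<mu>\<^sub>1, \<mu>\<^sub>2, \<mu>\<^sub>3)\<close>. For \<open>h = (a\<^sub>i\<^sub>j)\<close> in \<open>G\<close> put \<open>x = |a\<^sub>2\<^sub>3 a\<^sub>3\<^sub>2|\<^bsup>1/2\<^esup>\<close> and \<open>y = |a\<^sub>2\<^sub>2 a\<^sub>3\<^sub>3|\<^bsup>1/2\<^esup>\<close>.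
  If \<open>h\<close> moves the tube to a set meeting the tube, two points of the axes of \<open>g\<close> and \<open>h g h\<^sup>-\<^sup>1\<close> are at
  distance less than \<open>2r\<close>, which gives \<open>2xy \<le> x\<^sup>2 + y\<^sup>2 < cosh 2r \<le> 2(1 - M)/M\<^sup>2\<close>. The numbers \<open>x\<close>, \<open>y\<close>
  satisfy \<open>y \<le> 1 + x\<close>, and replacing \<open>h\<close> by \<open>h f h\<^sup>-\<^sup>1\<close> replaces \<open>x\<close> by a number at most \<open>M x y\<close>.
  Hence \<open>x < (1 - M)/M\<close> after one step, and iteration makes \<open>x\<close> tend to \<open>0\<close> within a bounded, hence
  finite, subset of \<open>G\<close>. So \<open>x\<close> vanishes eventually, and discreteness forces \<open>h\<close> to fix both end
  points of the axis; since \<open>g\<close> is primitive and \<open>G\<close> torsion-free, \<open>h\<close> is a power of \<open>g\<close>.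
\<close>


section \<open>Quaternions\<close>

lemma quat_sel [simp]:
  "qre 0 = 0" "qi 0 = 0" "qj 0 = 0" "qk 0 = 0"
  "qre 1 = 1" "qi 1 = 0" "qj 1 = 0" "qk 1 = 0"
  "qre (x + y) = qre x + qre y" "qi (x + y) = qi x + qi y"
  "qj (x + y) = qj x + qj y" "qk (x + y) = qk x + qk y"
  "qre (x - y) = qre x - qre y" "qi (x - y) = qi x - qi y"
  "qj (x - y) = qj x - qj y" "qk (x - y) = qk x - qk y"
  "qre (- x) = - qre x" "qi (- x) = - qi x" "qj (- x) = - qj x" "qk (- x) = - qk x"
  "qre (c *\<^sub>R x) = c * qre x" "qi (c *\<^sub>R x) = c * qi x"
  "qj (c *\<^sub>R x) = c * qj x" "qk (c *\<^sub>R x) = c * qk x"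
  "qre (qcnj x) = qre x" "qi (qcnj x) = - qi x" "qj (qcnj x) = - qj x" "qk (qcnj x) = - qk x"
  by (simp_all add: zero_quat_def one_quat_def plus_quat_def minus_quat_def uminus_quat_def
      scaleR_quat_def qcnj_def)

lemma quat_sel_of_real [simp]:
  "qre (of_real c) = c" "qi (of_real c) = 0" "qj (of_real c) = 0" "qk (of_real c) = 0"
  by (simp_all add: of_real_def)

lemma quat_sel_numeral [simp]:
  "qre (numeral n) = numeral n" "qi (numeral n) = 0" "qj (numeral n) = 0" "qk (numeral n) = 0"
  by (metis of_real_numeral quat_sel_of_real)+

lemma quat_sel_mult:
  "qre (x * y) = qre x * qre y - qi x * qi y - qj x * qj y - qk x * qk y"
  "qi (x * y) = qre x * qi y + qi x * qre y + qj x * qk y - qk x * qj y"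
  "qj (x * y) = qre x * qj y - qi x * qk y + qj x * qre y + qk x * qi y"
  "qk (x * y) = qre x * qk y + qi x * qj y - qj x * qi y + qk x * qre y"
  by (simp_all add: times_quat_def)

lemma quat_norm_sq: "(norm x)\<^sup>2 = (qre x)\<^sup>2 + (qi x)\<^sup>2 + (qj x)\<^sup>2 + (qk x)\<^sup>2" for x :: quat
  by (simp add: norm_quat_def)

text \<open>This gives the Bolzano-Weierstrass property for quaternionic matrices, on which
  \<open>finite_if_bounded\<close> rests.\<close>

instantiation quat :: euclidean_space
begin

definition "Basis = {Quat 1 0 0 0, Quat 0 1 0 0, Quat 0 0 1 0, Quat 0 0 0 1}"

instance
proof
  show "(Basis :: quat set) \<noteq> {}" "finite (Basis :: quat set)"
    by (simp_all add: Basis_quat_def)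
  show "u \<bullet> v = (if u = v then 1 else 0)" if "u \<in> Basis" "v \<in> Basis" for u v :: quat
    using that unfolding Basis_quat_def by (elim insertE) (simp_all add: inner_quat_def)
  show "(\<forall>u\<in>Basis. x \<bullet> u = 0) \<longleftrightarrow> x = 0" for x :: quat
    by (simp add: Basis_quat_def inner_quat_def) (simp add: quat_eq_iff)
qed

end

lemma qcnj_simps [simp]:
  "qcnj 0 = 0" "qcnj 1 = 1" "qcnj (x + y) = qcnj x + qcnj y" "qcnj (x - y) = qcnj x - qcnj y"
  "qcnj (- x) = - qcnj x" "qcnj (qcnj x) = x" "qcnj (of_real c) = of_real c"
  "qcnj x = 0 \<longleftrightarrow> x = 0"
  by (auto simp: quat_eq_iff)

lemma qcnj_mult [simp]: "qcnj (x * y) = qcnj y * qcnj x"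
  by (simp add: quat_eq_iff quat_sel_mult algebra_simps)

lemma norm_qcnj [simp]: "norm (qcnj x) = norm x"
  by (simp add: norm_quat_def)

lemma bounded_linear_qcnj: "bounded_linear qcnj"
  by (rule bounded_linear_intro[where K = 1]) (simp_all add: quat_eq_iff)

lemmas tendsto_qcnj = bounded_linear.tendsto[OF bounded_linear_qcnj]

lemma mult_qcnj: "x * qcnj x = of_real ((norm x)\<^sup>2)" "qcnj x * x = of_real ((norm x)\<^sup>2)"
  unfolding quat_norm_sq by (simp_all add: quat_eq_iff quat_sel_mult power2_eq_square)

lemma quat_of_real_commute: "x * of_real c = of_real c * (x :: quat)"
  by (simp add: quat_eq_iff quat_sel_mult)

lemma qre_le_norm: "qre x \<le> norm x"
  unfolding norm_quat_def by (rule real_le_rsqrt) simp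

lemma norm_diff_one_sq: "(norm (x - 1))\<^sup>2 = (norm x)\<^sup>2 + 1 - 2 * qre x" for x :: quat
  unfolding quat_norm_sq by (simp add: power2_eq_square algebra_simps)

lemma qre_eq_norm: "qre x = norm x \<Longrightarrow> x = of_real (norm x)" for x :: quat
  using quat_norm_sq[of x] by (simp add: quat_eq_iff add_nonneg_eq_0_iff)

text \<open>Every quaternion lies in a copy of the complex numbers spanned by 1 and a square root
  \<open>u\<close> of -1, namely its normalised vector part. For a real quaternion any such
  \<open>u\<close> will do.\<close>

lemma quat_polar:
  fixes x :: quat
  obtains \<theta> u where "u * u = -1" "x = of_real (norm x) * (of_real (cos \<theta>) + of_real (sin \<theta>) * u)"
proof -
  define v where "v = Quat 0 (qi x) (qj x) (qk x)"
  have v: "v * v = - of_real ((norm v)\<^sup>2)" "x = of_real (qre x) + v"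
    unfolding quat_norm_sq by (simp_all add: v_def quat_eq_iff quat_sel_mult power2_eq_square)
  have n: "(norm x)\<^sup>2 = (qre x)\<^sup>2 + (norm v)\<^sup>2"
    by (simp add: quat_norm_sq v_def)
  obtain u where u: "u * u = -1" "v = of_real (norm v) * u"
  proof (cases "v = 0")
    case True
    have "Quat 0 1 0 0 * Quat 0 1 0 0 = -1"
      by (simp add: quat_eq_iff quat_sel_mult)
    then show ?thesis
      using True that[of "Quat 0 1 0 0"] by simp
  next
    case False
    define u where "u = of_real (1 / norm v) * v"
    have "u * u = of_real (1 / norm v) * of_real (1 / norm v) * (v * v)"
      unfolding u_def by (metis mult.assoc quat_of_real_commute)
    also have "\<dots> = - of_real (1 / norm v * (1 / norm v) * (norm v)\<^sup>2)"
      unfolding v(1) by (simp only: of_real_mult mult_minus_right)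
    also have "\<dots> = -1"
      using False by (simp add: power2_eq_square del: of_real_mult)
    finally have "u * u = -1" .
    moreover have "v = of_real (norm v) * u"
      unfolding u_def mult.assoc[symmetric] of_real_mult[symmetric] using False by simp
    ultimately show ?thesis using that by blast
  qed
  show ?thesis
  proof (cases "x = 0")
    case True
    then show ?thesis using that[of u 0] u by simp
  next
    case False
    have "(qre x / norm x)\<^sup>2 + (norm v / norm x)\<^sup>2 = ((qre x)\<^sup>2 + (norm v)\<^sup>2) / (norm x)\<^sup>2"
      by (simp add: power_divide add_divide_distrib)
    also have "\<dots> = 1"
      using False unfolding n[symmetric] by simp
    finally have "(qre x / norm x)\<^sup>2 + (norm v / norm x)\<^sup>2 = 1" .
    then obtain \<theta> where \<theta>: "qre x / norm x = cos \<theta>" "norm v / norm x = sin \<theta>"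
      using sincos_total_2pi_le by metis
    then have "qre x = norm x * cos \<theta>" "norm v = norm x * sin \<theta>"
      using False by (auto simp: field_simps)
    then have "x = of_real (norm x * cos \<theta>) + of_real (norm x * sin \<theta>) * u"
      using v(2) u(2) by metis
    then show ?thesis using that[of u \<theta>] u(1) by (simp add: algebra_simps mult.assoc)
  qed
qed

lemma quat_de_moivre:
  assumes "u * u = (-1 :: quat)"
  shows "(of_real (cos \<theta>) + of_real (sin \<theta>) * u) ^ n
    = of_real (cos (real n * \<theta>)) + of_real (sin (real n * \<theta>)) * u"
proof (induction n)
  case (Suc n)
  have *: "(of_real a + of_real b * u) * (of_real c + of_real d * u)
    = of_real (a * c - b * d) + of_real (a * d + b * c) * u" for a b c d
  proof -
    have "of_real b * u * (of_real d * u) = of_real b * of_real d * (u * u)"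
      by (metis mult.assoc quat_of_real_commute)
    moreover have "of_real b * u * of_real c = of_real b * of_real c * u"
      by (metis mult.assoc quat_of_real_commute)
    ultimately show ?thesis
      by (simp add: algebra_simps assms)
  qed
  show ?case
    unfolding power_Suc Suc *
    by (simp add: algebra_simps cos_add sin_add)
qed simp

text \<open>All powers of \<open>x\<close> stay in one complex plane, where de Moivre's formula
  applies. The angle is the same for every \<open>n\<close>, as the pigeonhole argument
  requires.\<close>

lemma qre_power:
  obtains \<theta> where "\<And>n. qre (x ^ n) = norm x ^ n * cos (real n * \<theta>)"
proof -
  obtain \<theta> u where u: "u * u = -1"
    and x: "x = of_real (norm x) * (of_real (cos \<theta>) + of_real (sin \<theta>) * u)"
    by (rule quat_polar)
  have "qre u = 0"
  proof (rule ccontr)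
    assume "qre u \<noteq> 0"
    \<comment> \<open>The vector part of \<open>u * u\<close> is \<open>2 * qre u\<close> times that
      of \<open>u\<close>, so a nonzero real part would make \<open>u\<close> real with square
      -1.\<close>
    then have "qi u = 0" "qj u = 0" "qk u = 0" and "qre u * qre u + 1 = 0"
      using u by (auto simp: quat_eq_iff quat_sel_mult algebra_simps)
    then show False
      using zero_le_square[of "qre u"] by linarith
  qed
  moreover have "x ^ n = of_real (norm x ^ n) * (of_real (cos (real n * \<theta>)) + of_real (sin (real n * \<theta>)) * u)" for n
  proof -
    have "x ^ n = (norm x) ^ n *\<^sub>R (of_real (cos \<theta>) + of_real (sin \<theta>) * u) ^ n"
      by (subst x) (simp only: scaleR_power flip: scaleR_conv_of_real)
    then show ?thesis by (simp add: quat_de_moivre[OF u] scaleR_conv_of_real)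
  qed
  ultimately have "qre (x ^ n) = norm x ^ n * cos (real n * \<theta>)" for n
    by (simp add: quat_sel_mult del: of_real_power)
  then show ?thesis by (rule that)
qed

section \<open>Matrices preserving the Hermitian form\<close>

lemma matrix_eq_3:
  fixes A B :: "'a^3^3"
  shows "A = B \<longleftrightarrow> A$1$1 = B$1$1 \<and> A$1$2 = B$1$2 \<and> A$1$3 = B$1$3 \<and> A$2$1 = B$2$1 \<and> A$2$2 = B$2$2
    \<and> A$2$3 = B$2$3 \<and> A$3$1 = B$3$1 \<and> A$3$2 = B$3$2 \<and> A$3$3 = B$3$3"
  by (auto simp: vec_eq_iff forall_3)

lemma matrix_mult_3:
  fixes A B :: "'a::semiring_1^3^3"
  shows "(A ** B) $ i $ j = A$i$1 * B$1$j + A$i$2 * B$2$j + A$i$3 * B$3$j"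
  by (simp add: matrix_matrix_mult_def sum_3)

lemma matrix_vector_mult_3:
  fixes A :: "'a::semiring_1^3^3"
  shows "(A *v z) $ i = A$i$1 * z$1 + A$i$2 * z$2 + A$i$3 * z$3"
  by (simp add: matrix_vector_mult_def sum_3)

lemma diag3_nth [simp]:
  "diag3 a b c $ 1 $ 1 = a" "diag3 a b c $ 1 $ 2 = 0" "diag3 a b c $ 1 $ 3 = 0"
  "diag3 a b c $ 2 $ 1 = 0" "diag3 a b c $ 2 $ 2 = b" "diag3 a b c $ 2 $ 3 = 0"
  "diag3 a b c $ 3 $ 1 = 0" "diag3 a b c $ 3 $ 2 = 0" "diag3 a b c $ 3 $ 3 = c"
  by (simp_all add: diag3_def)

lemma mat_one_nth [simp]:
  "(mat 1 :: 'a::semiring_1^3^3) $ 1 $ 1 = 1" "(mat 1 :: 'a^3^3) $ 1 $ 2 = 0"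
  "(mat 1 :: 'a^3^3) $ 1 $ 3 = 0" "(mat 1 :: 'a^3^3) $ 2 $ 1 = 0" "(mat 1 :: 'a^3^3) $ 2 $ 2 = 1"
  "(mat 1 :: 'a^3^3) $ 2 $ 3 = 0" "(mat 1 :: 'a^3^3) $ 3 $ 1 = 0" "(mat 1 :: 'a^3^3) $ 3 $ 2 = 0"
  "(mat 1 :: 'a^3^3) $ 3 $ 3 = 1"
  by (simp_all add: mat_def)

text \<open>This is \<open>J A\<^sup>* J\<close>, where \<open>J\<close> is the matrix of the Hermitian form.\<close>
definition sp_inv :: "quat^3^3 \<Rightarrow> quat^3^3" where
  "sp_inv A = vector
    [vector [qcnj (A$1$1), - qcnj (A$3$1), - qcnj (A$2$1)],
     vector [- qcnj (A$1$3), qcnj (A$3$3), qcnj (A$2$3)],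
     vector [- qcnj (A$1$2), qcnj (A$3$2), qcnj (A$2$2)]]"

lemma sp_inv_nth [simp]:
  "sp_inv A $ 1 $ 1 = qcnj (A$1$1)" "sp_inv A $ 1 $ 2 = - qcnj (A$3$1)"
  "sp_inv A $ 1 $ 3 = - qcnj (A$2$1)" "sp_inv A $ 2 $ 1 = - qcnj (A$1$3)"
  "sp_inv A $ 2 $ 2 = qcnj (A$3$3)" "sp_inv A $ 2 $ 3 = qcnj (A$2$3)"
  "sp_inv A $ 3 $ 1 = - qcnj (A$1$2)" "sp_inv A $ 3 $ 2 = qcnj (A$3$2)"
  "sp_inv A $ 3 $ 3 = qcnj (A$2$2)"
  by (simp_all add: sp_inv_def)

text \<open>Invariance of the form on pairs of standard basis vectors gives nine equations, which
  are the entries of this identity up to sign and order of the rows.\<close>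

lemma sp_inv_left:
  assumes "A \<in> Sp21_set"
  shows "sp_inv A ** A = mat 1"
proof -
  have "herm (A *v axis i 1) (A *v axis j 1) = herm (axis i 1) (axis j 1)" for i j
    using assms by (simp add: Sp21_set_def)
  then have *: "qcnj (A$1$j) * A$1$i - (qcnj (A$2$j) * A$3$i + qcnj (A$3$j) * A$2$i)
    = herm (axis i 1) (axis j 1)" for i j
    by (simp add: herm_def matrix_vector_mult_def axis_def if_distrib cong: if_cong)
  show ?thesis
    using *[of 1 1] *[of 1 2] *[of 1 3] *[of 2 1] *[of 2 2] *[of 2 3] *[of 3 1] *[of 3 2] *[of 3 3]
    unfolding matrix_eq_3 by (simp add: matrix_mult_3 herm_def axis_def algebra_simps)
qed

lemma sp_inv_right:
  assumes "A \<in> Sp21_set"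
  shows "A ** sp_inv A = mat 1"
proof -
  obtain B where B: "A ** B = mat 1" "B ** A = mat 1"
    using assms by (auto simp: Sp21_set_def invertible_def)
  have "sp_inv A = sp_inv A ** (A ** B)"
    by (simp add: B)
  also have "\<dots> = B"
    unfolding matrix_mul_assoc sp_inv_left[OF assms] by simp
  finally show ?thesis using B by simp
qed

section \<open>Relations between the entries of a matrix in Sp(2,1)\<close>

lemma qre_qcnj_mult_commute: "qre (qcnj x * y) = qre (qcnj y * x)"
  by (simp add: quat_sel_mult)

lemma qre_null_relation:
  assumes "a * qcnj b + b * qcnj a = c * qcnj c"
  shows "(norm c)\<^sup>2 = 2 * qre (a * qcnj b)"
proof -
  have "qre (a * qcnj b + b * qcnj a) = qre (c * qcnj c)" using assms by simp
  then show ?thesis unfolding quat_norm_sq by (simp add: quat_sel_mult power2_eq_square)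
qed

lemma Sp21_row_relations:
  assumes "A \<in> Sp21_set"
  shows "(norm (A$2$1))\<^sup>2 = 2 * qre (A$2$2 * qcnj (A$2$3))"
    and "(norm (A$3$1))\<^sup>2 = 2 * qre (A$3$2 * qcnj (A$3$3))"
    and "A$2$2 * qcnj (A$3$3) + A$2$3 * qcnj (A$3$2) = 1 + A$2$1 * qcnj (A$3$1)"
  using sp_inv_right[OF assms] unfolding matrix_eq_3
  by (auto simp: matrix_mult_3 algebra_simps intro!: qre_null_relation)

lemma Sp21_column_relations:
  assumes "A \<in> Sp21_set"
  shows "(norm (A$1$2))\<^sup>2 = 2 * qre (qcnj (A$2$2) * A$3$2)"
    and "(norm (A$1$3))\<^sup>2 = 2 * qre (qcnj (A$2$3) * A$3$3)"
    and "(norm (A$1$1))\<^sup>2 = 1 + 2 * qre (qcnj (A$2$1) * A$3$1)"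
    and "qcnj (A$2$3) * A$3$2 + qcnj (A$3$3) * A$2$2 = 1 + qcnj (A$1$3) * A$1$2"
proof -
  have R: "qcnj (A$1$i) * A$1$i - (qcnj (A$2$i) * A$3$i + qcnj (A$3$i) * A$2$i) = of_real c
    \<Longrightarrow> (norm (A$1$i))\<^sup>2 = c + 2 * qre (qcnj (A$2$i) * A$3$i)" for c i
    unfolding quat_norm_sq by (auto simp: quat_eq_iff quat_sel_mult power2_eq_square)
  note S = sp_inv_left[OF assms, unfolded matrix_eq_3 matrix_mult_3, simplified]
  show "(norm (A$1$2))\<^sup>2 = 2 * qre (qcnj (A$2$2) * A$3$2)"
    "(norm (A$1$3))\<^sup>2 = 2 * qre (qcnj (A$2$3) * A$3$3)"
    "(norm (A$1$1))\<^sup>2 = 1 + 2 * qre (qcnj (A$2$1) * A$3$1)"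
    using R[of 2 0] R[of 3 0] R[of 1 1] S by (simp_all add: algebra_simps)
  show "qcnj (A$2$3) * A$3$2 + qcnj (A$3$3) * A$2$2 = 1 + qcnj (A$1$3) * A$1$2"
    using S by (simp add: algebra_simps)
qed

lemma qre_le_norm_mult:
  "qre (a * qcnj b) \<le> norm a * norm b" "qre (qcnj a * b) \<le> norm a * norm b"
  using qre_le_norm[of "a * qcnj b"] qre_le_norm[of "qcnj a * b"] by (simp_all add: norm_mult)

text \<open>Real parts in the preceding relations are replaced by moduli. As a result the corner
  block of rows and columns 2 and 3 controls the whole matrix.\<close>

lemma Sp21_entry_bounds:
  assumes "A \<in> Sp21_set"
  shows "(norm (A$2$1))\<^sup>2 \<le> 2 * (norm (A$2$2) * norm (A$2$3))"
    and "(norm (A$3$1))\<^sup>2 \<le> 2 * (norm (A$3$2) * norm (A$3$3))"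
    and "(norm (A$1$2))\<^sup>2 \<le> 2 * (norm (A$2$2) * norm (A$3$2))"
    and "(norm (A$1$3))\<^sup>2 \<le> 2 * (norm (A$2$3) * norm (A$3$3))"
    and "(norm (A$1$1))\<^sup>2 \<le> 1 + 2 * (norm (A$2$1) * norm (A$3$1))"
  using Sp21_row_relations[OF assms] Sp21_column_relations[OF assms] qre_le_norm_mult
  by (smt (verit))+

text \<open>The corner entries of \<open>A\<close> in the symplectic group have the moduli of the
  Hermitian products of e2, e3 with A e2, A e3, so the squares of \<open>cross_x\<close> and
  \<open>cross_y\<close> are absolute cross-ratios of these four boundary points. If
  \<open>cross_x A\<close> is 0, then \<open>A\<close> fixes one of the points e2, e3.\<close>

definition cross_x :: "quat^3^3 \<Rightarrow> real" where
  "cross_x A = sqrt (norm (A$2$3) * norm (A$3$2))"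

definition cross_y :: "quat^3^3 \<Rightarrow> real" where
  "cross_y A = sqrt (norm (A$2$2) * norm (A$3$3))"

lemma cross_nonneg [simp]: "cross_x A \<ge> 0" "cross_y A \<ge> 0"
  by (simp_all add: cross_x_def cross_y_def)

lemma cross_sq:
  "(cross_x A)\<^sup>2 = norm (A$2$3) * norm (A$3$2)"
  "(cross_y A)\<^sup>2 = norm (A$2$2) * norm (A$3$3)"
  by (simp_all add: cross_x_def cross_y_def)

text \<open>Ptolemy's inequality for the four boundary points \<open>e\<^sub>2, e\<^sub>3, A e\<^sub>2, A e\<^sub>3\<close>, in which
  \<open>|\<langle>p,q\<rangle>|\<close> plays the role of the squared distance. As for the Cygan metric, it is reduced to the
  triangle inequality by rescaling \<open>A e\<^sub>2\<close> so that its last coordinate agrees with that of \<open>A e\<^sub>3\<close>.\<close>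
lemma cross_y_le:
  assumes A: "A \<in> Sp21_set"
  shows "cross_y A \<le> 1 + cross_x A"
proof -
  note C = Sp21_column_relations[OF A]
  \<comment> \<open>In the first case the left side is 0. In the second also
    \<open>A$1$2 = 0\<close>, and the relation between columns 2 and 3 gives
    \<open>cross_y A = 1\<close>.\<close>
  consider "A$3$3 = 0" | "A$3$2 = 0" | "A$3$3 \<noteq> 0" "A$3$2 \<noteq> 0" by blast
  then show ?thesis
  proof cases
    case 1
    then show ?thesis by (simp add: cross_y_def add_nonneg_nonneg)
  next
    case 2
    then have "norm (qcnj (A$3$3) * A$2$2) = 1" using C by simp
    then show ?thesis by (simp add: cross_y_def norm_mult mult.commute)
  next
    case 3
    define q where "q = inverse (A$3$2) * A$3$3"
    have q: "norm q = norm (A$3$3) / norm (A$3$2)" "q \<noteq> 0" "A$3$2 * q = A$3$3"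
      using 3 by (simp_all add: q_def norm_mult norm_inverse divide_inverse mult.assoc[symmetric])
    \<comment> \<open>These are the first two entries of A e2 q - A e3, whose third entry is 0 by
      the choice of \<open>q\<close>. Columns 2 and 3 are null vectors with Hermitian product -1;
      pairing the difference with A e3 gives the fact \<open>D2\<close>, pairing it with itself
      gives the fact \<open>D1\<close>.\<close>
    define D1 where "D1 = A$1$2 * q - A$1$3"
    define D2 where "D2 = A$2$2 * q - A$2$3"
    have z: "qcnj (A$3$3) * A$2$2 * q = q + qcnj (A$1$3) * A$1$2 * q - qcnj (A$2$3) * A$3$3"
    proof -
      have "qcnj (A$3$3) * A$2$2 * q = (1 + qcnj (A$1$3) * A$1$2 - qcnj (A$2$3) * A$3$2) * q"
        by (simp flip: C(4))
      then show ?thesis by (simp add: algebra_simps q(3) mult.assoc)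
    qed
    have D2: "qcnj (A$3$3) * D2 = q + qcnj (A$1$3) * D1"
    proof -
      have "qcnj (A$1$3) * A$1$3 = qcnj (A$2$3) * A$3$3 + qcnj (A$3$3) * A$2$3"
        using sp_inv_left[OF A] unfolding matrix_eq_3 by (simp add: matrix_mult_3 algebra_simps)
      then show ?thesis
        by (simp add: D1_def D2_def right_diff_distrib z[unfolded mult.assoc] mult.assoc)
    qed
    have D1: "(norm D1)\<^sup>2 = 2 * qre q"
    proof -
      have "qcnj (A$1$2) * A$1$2 = qcnj (A$2$2) * A$3$2 + qcnj (A$3$2) * A$2$2"
        using sp_inv_left[OF A] unfolding matrix_eq_3 by (simp add: matrix_mult_3 algebra_simps)
      then have "qcnj q * (qcnj (A$1$2) * A$1$2) * q = qcnj q * (qcnj (A$2$2) * A$3$2 + qcnj (A$3$2) * A$2$2) * q"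
        by simp
      then have "(qcnj (A$1$2 * q)) * (A$1$2 * q) = qcnj (A$2$2 * q) * (A$3$2 * q) + qcnj (A$3$2 * q) * (A$2$2 * q)"
        by (simp add: algebra_simps mult.assoc)
      then have "of_real ((norm (A$1$2 * q))\<^sup>2) = qcnj (A$2$2 * q) * A$3$3 + qcnj (A$3$3) * (A$2$2 * q)"
        unfolding q(3) mult_qcnj .
      then have "qre (of_real ((norm (A$1$2 * q))\<^sup>2)) = qre (qcnj (A$2$2 * q) * A$3$3) + qre (qcnj (A$3$3) * (A$2$2 * q))"
        by (simp only: quat_sel)
      then have 1: "(norm (A$1$2 * q))\<^sup>2 = 2 * qre (qcnj (A$3$3) * A$2$2 * q)"
        using qre_qcnj_mult_commute[of "A$2$2 * q" "A$3$3"] by (simp only: quat_sel_of_real mult.assoc)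
      have "(norm D1)\<^sup>2 = (norm (A$1$2 * q))\<^sup>2 + (norm (A$1$3))\<^sup>2 - 2 * qre (qcnj (A$1$3) * (A$1$2 * q))"
        unfolding D1_def quat_norm_sq by (simp add: quat_sel_mult power2_eq_square algebra_simps)
      then show ?thesis unfolding 1 z C(2) by (simp add: mult.assoc)
    qed
    have D1le: "(norm D1)\<^sup>2 \<le> 2 * norm q"
      using D1 qre_le_norm[of q] by simp
    have "norm (A$2$2) * norm (A$3$3) * norm q = norm (qcnj (A$3$3) * (A$2$3 + D2))"
      by (simp add: D2_def norm_mult)
    also have "\<dots> = norm (qcnj (A$3$3) * A$2$3 + (q + qcnj (A$1$3) * D1))"
      by (simp add: distrib_left D2)
    also have "\<dots> \<le> norm (qcnj (A$3$3) * A$2$3) + (norm q + norm (qcnj (A$1$3) * D1))"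
      by (intro norm_triangle_le order_refl add_left_mono)+
    also have "\<dots> = norm (A$3$3) * norm (A$2$3) + norm q + norm (A$1$3) * norm D1"
      by (simp add: norm_mult)
    also have "norm (A$1$3) * norm D1 \<le> 2 * (cross_x A * norm q)"
    proof (rule power2_le_imp_le)
      have "(norm (A$1$3) * norm D1)\<^sup>2 \<le> (2 * (norm (A$2$3) * norm (A$3$3))) * (2 * norm q)"
        unfolding power_mult_distrib
        using Sp21_entry_bounds(4)[OF A] D1le by (intro mult_mono) simp_all
      also have "\<dots> = (2 * (cross_x A * norm q))\<^sup>2"
        unfolding power_mult_distrib cross_sq q(1) using 3 by (simp add: power2_eq_square)
      finally show "(norm (A$1$3) * norm D1)\<^sup>2 \<le> (2 * (cross_x A * norm q))\<^sup>2" .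
    qed simp
    also have "norm (A$3$3) * norm (A$2$3) = (cross_x A)\<^sup>2 * norm q"
      unfolding cross_sq q(1) using 3 by simp
    finally have "(cross_y A)\<^sup>2 * norm q \<le> (1 + cross_x A)\<^sup>2 * norm q"
      unfolding cross_sq(2) by (simp add: power2_sum algebra_simps)
    then have "(cross_y A)\<^sup>2 \<le> (1 + cross_x A)\<^sup>2"
      using q(2) by simp
    then show ?thesis by (rule power2_le_imp_le) simp
  qed
qed

lemma norm_21_31_le:
  assumes A: "A \<in> Sp21_set"
  shows "norm (A$2$1) * norm (A$3$1) \<le> 2 * (cross_x A * cross_y A)"
proof (rule power2_le_imp_le)
  have "(norm (A$2$1) * norm (A$3$1))\<^sup>2
    \<le> (2 * (norm (A$2$2) * norm (A$2$3))) * (2 * (norm (A$3$2) * norm (A$3$3)))"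
    unfolding power_mult_distrib using Sp21_entry_bounds[OF A] by (intro mult_mono) auto
  also have "\<dots> = (2 * (cross_x A * cross_y A))\<^sup>2"
    unfolding power_mult_distrib cross_sq by simp
  finally show "(norm (A$2$1) * norm (A$3$1))\<^sup>2 \<le> (2 * (cross_x A * cross_y A))\<^sup>2" .
qed simp

section \<open>Corner entries of conjugates of diagonal matrices\<close>

lemma conj_diag3_nth:
  "(A ** diag3 a b c ** sp_inv A) $ 2 $ 2 = - A$2$1 * a * qcnj (A$3$1) + A$2$2 * b * qcnj (A$3$3) + A$2$3 * c * qcnj (A$3$2)"
  "(A ** diag3 a b c ** sp_inv A) $ 3 $ 3 = - A$3$1 * a * qcnj (A$2$1) + A$3$2 * b * qcnj (A$2$3) + A$3$3 * c * qcnj (A$2$2)"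
  "(A ** diag3 a b c ** sp_inv A) $ 2 $ 3 = - A$2$1 * a * qcnj (A$2$1) + A$2$2 * b * qcnj (A$2$3) + A$2$3 * c * qcnj (A$2$2)"
  "(A ** diag3 a b c ** sp_inv A) $ 3 $ 2 = - A$3$1 * a * qcnj (A$3$1) + A$3$2 * b * qcnj (A$3$3) + A$3$3 * c * qcnj (A$3$2)"
  by (simp_all add: matrix_mult_3)

text \<open>For \<open>a = b = c = 1\<close> the conjugate is the identity and these entries are 0,
  so only \<open>a - 1\<close>, \<open>b - 1\<close>, \<open>c - 1\<close> contribute. The factor 2
  comes from \<open>Sp21_entry_bounds\<close>, applied to the term through column 1.\<close>

lemma conj_diag3_off:
  assumes A: "A \<in> Sp21_set"
  shows "norm ((A ** diag3 a b c ** sp_inv A) $ 2 $ 3)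
      \<le> (2 * norm (a - 1) + norm (b - 1) + norm (c - 1)) * (norm (A$2$2) * norm (A$2$3))" (is ?A)
    and "norm ((A ** diag3 a b c ** sp_inv A) $ 3 $ 2)
      \<le> (2 * norm (a - 1) + norm (b - 1) + norm (c - 1)) * (norm (A$3$2) * norm (A$3$3))" (is ?B)
proof -
  have *: "norm (- x * a * qcnj x + y * b * qcnj z + z * c * qcnj y)
      \<le> (2 * norm (a - 1) + norm (b - 1) + norm (c - 1)) * (norm y * norm z)"
    if 0: "- x * qcnj x + y * qcnj z + z * qcnj y = 0" and l: "(norm x)\<^sup>2 \<le> 2 * (norm y * norm z)"
    for x y z
  proof -
    have "- x * a * qcnj x + y * b * qcnj z + z * c * qcnj y
      = - (x * (a - 1) * qcnj x) + y * (b - 1) * qcnj z + z * (c - 1) * qcnj y"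
      using 0 by (simp add: algebra_simps)
    also have "norm \<dots> \<le> norm (x * (a - 1) * qcnj x) + norm (y * (b - 1) * qcnj z) + norm (z * (c - 1) * qcnj y)"
      by (metis norm_minus_cancel norm_triangle_le norm_triangle_ineq add_right_mono)
    also have "\<dots> = (norm x)\<^sup>2 * norm (a - 1) + (norm (b - 1) + norm (c - 1)) * (norm y * norm z)"
      unfolding norm_mult norm_qcnj by (simp add: algebra_simps power2_eq_square)
    also have "\<dots> \<le> 2 * (norm y * norm z) * norm (a - 1) + (norm (b - 1) + norm (c - 1)) * (norm y * norm z)"
      by (intro add_right_mono mult_right_mono l) simp
    finally show ?thesis by (simp add: algebra_simps)
  qed
  have "- A$2$1 * qcnj (A$2$1) + A$2$2 * qcnj (A$2$3) + A$2$3 * qcnj (A$2$2) = 0"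
    "- A$3$1 * qcnj (A$3$1) + A$3$2 * qcnj (A$3$3) + A$3$3 * qcnj (A$3$2) = 0"
    using sp_inv_right[OF A] unfolding matrix_eq_3 by (simp_all add: matrix_mult_3)
  then show ?A ?B
    unfolding conj_diag3_nth using Sp21_entry_bounds[OF A] by (intro *; simp)+
qed

text \<open>All three diagonal moduli are at most \<open>L\<close>. The terms through columns 2 and
  3 give the two squares in the expanded right side, and the term through column 1 gives the mixed
  product by \<open>norm_21_31_le\<close>.\<close>

lemma conj_diag3_diag:
  assumes A: "A \<in> Sp21_set" and "norm a = 1" "norm b = L" "norm c = inverse L" "L \<ge> 1"
  shows "norm ((A ** diag3 a b c ** sp_inv A) $ 2 $ 2) \<le> L * (cross_x A + cross_y A)\<^sup>2" (is ?A)
    and "norm ((A ** diag3 a b c ** sp_inv A) $ 3 $ 3) \<le> L * (cross_x A + cross_y A)\<^sup>2" (is ?B)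
proof -
  have L: "inverse L \<le> L" using \<open>L \<ge> 1\<close> by (meson inverse_le_1_iff order_trans)
  have tri: "norm (- x + y + z) \<le> norm x + norm y + norm z" for x y z :: quat
    by (metis norm_minus_cancel norm_triangle_le norm_triangle_ineq add_right_mono)
  have "norm (A$2$1) * norm (A$3$1) \<le> L * (2 * (cross_x A * cross_y A))"
    using norm_21_31_le[OF A] mult_right_mono[OF \<open>L \<ge> 1\<close>, of "2 * (cross_x A * cross_y A)"] by simp
  moreover have "inverse L * (norm (A$2$3) * norm (A$3$2)) \<le> L * (norm (A$2$3) * norm (A$3$2))"
    "inverse L * (norm (A$2$2) * norm (A$3$3)) \<le> L * (norm (A$2$2) * norm (A$3$3))"
    by (intro mult_right_mono L; simp)+
  ultimately show ?A ?B
    unfolding conj_diag3_nth power2_sum cross_sq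
    using tri[of "A$2$1 * a * qcnj (A$3$1)" "A$2$2 * b * qcnj (A$3$3)" "A$2$3 * c * qcnj (A$3$2)"]
      tri[of "A$3$1 * a * qcnj (A$2$1)" "A$3$2 * b * qcnj (A$2$3)" "A$3$3 * c * qcnj (A$2$2)"]
    by (simp_all add: norm_mult assms algebra_simps)
qed

text \<open>The product of the two bounds in \<open>conj_diag3_off\<close> is the square of the
  right side. This is the recursion that drives the Joergensen argument.\<close>

lemma cross_x_conj_diag3:
  assumes A: "A \<in> Sp21_set" and M: "M = 2 * norm (a - 1) + norm (b - 1) + norm (c - 1)"
  shows "cross_x (A ** diag3 a b c ** sp_inv A) \<le> M * (cross_x A * cross_y A)"
proof (rule power2_le_imp_le)
  have "(cross_x (A ** diag3 a b c ** sp_inv A))\<^sup>2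
    \<le> (M * (norm (A$2$2) * norm (A$2$3))) * (M * (norm (A$3$2) * norm (A$3$3)))"
    unfolding cross_sq M by (intro mult_mono conj_diag3_off A) auto
  also have "\<dots> = (M * (cross_x A * cross_y A))\<^sup>2"
    unfolding power_mult_distrib cross_sq by (simp add: power2_eq_square)
  finally show "(cross_x (A ** diag3 a b c ** sp_inv A))\<^sup>2 \<le> (M * (cross_x A * cross_y A))\<^sup>2" .
qed (simp add: M)

section \<open>Discrete torsion-free subgroups\<close>

lemma vec3_tendsto_iff:
  fixes f :: "'b \<Rightarrow> 'a::topological_space^3^3"
  shows "(f \<longlongrightarrow> A) F \<longleftrightarrow> (\<forall>i j. ((\<lambda>x. f x $ i $ j) \<longlongrightarrow> A $ i $ j) F)"
proof
  show "\<forall>i j. ((\<lambda>x. f x $ i $ j) \<longlongrightarrow> A $ i $ j) F" if "(f \<longlongrightarrow> A) F"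
    using that by (intro allI tendsto_vec_nth)
  show "(f \<longlongrightarrow> A) F" if "\<forall>i j. ((\<lambda>x. f x $ i $ j) \<longlongrightarrow> A $ i $ j) F"
    using that by (intro vec_tendstoI) blast
qed

lemma norm_vec_le_sum: "norm x \<le> (\<Sum>i\<in>UNIV. norm (x $ i))"
  by (simp add: norm_vec_def L2_set_le_sum)

lemma tendsto_sp_inv: "(f \<longlongrightarrow> A) F \<Longrightarrow> ((\<lambda>x. sp_inv (f x)) \<longlongrightarrow> sp_inv A) F"
  unfolding vec3_tendsto_iff by (simp add: forall_3 tendsto_qcnj tendsto_minus)

lemma tendsto_matrix_mult_3:
  fixes A B :: "'a::real_normed_algebra_1^3^3"
  assumes "(f \<longlongrightarrow> A) F" "(g \<longlongrightarrow> B) F"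
  shows "((\<lambda>x. f x ** g x) \<longlongrightarrow> A ** B) F"
  unfolding vec3_tendsto_iff[of "\<lambda>x. f x ** g x"] matrix_mult_3
  by (intro allI tendsto_intros assms)

section \<open>Group operations of \<open>Sp21\<close> and diagonal matrices\<close>

lemma carrier_Sp21 [simp]: "carrier Sp21 = Sp21_set"
  and mult_Sp21 [simp]: "A \<otimes>\<^bsub>Sp21\<^esub> B = A ** B"
  and one_Sp21 [simp]: "\<one>\<^bsub>Sp21\<^esub> = mat 1"
  by (simp_all add: Sp21_def)

lemma pow_Sp21 [simp]:
  "A [^]\<^bsub>Sp21\<^esub> (0::nat) = mat 1" "A [^]\<^bsub>Sp21\<^esub> Suc n = A [^]\<^bsub>Sp21\<^esub> n ** A"
  by (simp_all add: nat_pow_def)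

lemma inv_Sp21:
  assumes A: "A \<in> Sp21_set"
  shows "inv\<^bsub>Sp21\<^esub> A = sp_inv A"
proof -
  interpret group Sp21 by (rule group_Sp21)
  have "sp_inv A = sp_inv A ** (A ** inv\<^bsub>Sp21\<^esub> A)"
    using r_inv[of A] A by simp
  also have "\<dots> = inv\<^bsub>Sp21\<^esub> A"
    unfolding matrix_mul_assoc sp_inv_left[OF A] by simp
  finally show ?thesis by simp
qed

lemma diag3_mult: "diag3 a b c ** diag3 a' b' c' = diag3 (a * a') (b * b') (c * c')"
  unfolding matrix_eq_3 matrix_mult_3 by simp

lemma mat_one_eq_diag3: "mat 1 = diag3 1 1 1"
  unfolding matrix_eq_3 by simp

lemma diag3_pow: "diag3 a b c [^]\<^bsub>Sp21\<^esub> n = diag3 (a ^ n) (b ^ n) (c ^ n)"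
  by (induction n) (simp_all add: mat_one_eq_diag3 diag3_mult power_commutes)

text \<open>The bounds on the other four off-diagonal entries all contain a factor
  \<open>norm (A$2$3)\<close> or \<open>norm (A$3$2)\<close>.\<close>

lemma Sp21_diagI:
  assumes A: "A \<in> Sp21_set" and "A$2$3 = 0" "A$3$2 = 0"
  shows "A = diag3 (A$1$1) (A$2$2) (A$3$3)" "norm (A$1$1) = 1" "norm (A$2$2) * norm (A$3$3) = 1"
proof -
  have 0: "A$2$1 = 0" "A$3$1 = 0" "A$1$2 = 0" "A$1$3 = 0"
    using Sp21_entry_bounds[OF A] assms(2,3) by auto
  then show "A = diag3 (A$1$1) (A$2$2) (A$3$3)"
    unfolding matrix_eq_3 using assms by simp
  show "norm (A$1$1) = 1"
    using Sp21_column_relations(3)[OF A] 0 by (simp add: power2_eq_1_iff) (smt (verit) norm_ge_zero)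
  have "norm (A$2$2 * qcnj (A$3$3)) = 1"
    using Sp21_row_relations(3)[OF A] 0 assms by simp
  then show "norm (A$2$2) * norm (A$3$3) = 1" by (simp add: norm_mult)
qed

locale discrete_torsion_free =
  fixes G :: "(quat^3^3) set"
  assumes subgroup_G: "subgroup G Sp21"
    and discrete_G: "discrete G"
    and torsion_free_G: "torsion_free G"
begin

lemma in_Sp21: "A \<in> G \<Longrightarrow> A \<in> Sp21_set"
  using subgroup.subset[OF subgroup_G] by auto

lemma one_closed: "mat 1 \<in> G"
  using subgroup.one_closed[OF subgroup_G] by simp

lemma mult_closed: "A \<in> G \<Longrightarrow> B \<in> G \<Longrightarrow> A ** B \<in> G"
  using subgroup.m_closed[OF subgroup_G] by simp

lemma sp_inv_closed: "A \<in> G \<Longrightarrow> sp_inv A \<in> G"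
  using subgroup.m_inv_closed[OF subgroup_G] inv_Sp21[OF in_Sp21] by simp

lemma pow_closed: "A \<in> G \<Longrightarrow> A [^]\<^bsub>Sp21\<^esub> (n::nat) \<in> G"
  by (induction n) (simp_all add: one_closed mult_closed)

text \<open>Quotients of consecutive terms of a convergent sequence in \<open>G\<close> tend to the
  identity, which is isolated in \<open>G\<close>. So the sequence is eventually constant, although
  its terms were chosen different from the limit.\<close>

lemma finite_if_bounded:
  assumes "bounded S" "S \<subseteq> G"
  shows "finite S"
proof (rule ccontr)
  assume "infinite S"
  then obtain A where "A islimpt S"
    using bounded_infinite_imp_islimpt[of S S] assms by auto
  then obtain f where f: "\<And>n. f n \<in> S - {A}" "f \<longlonglongrightarrow> A"
    unfolding islimpt_sequential by auto
  have G: "f n \<in> G" for n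
    using f(1) assms by auto
  \<comment> \<open>The limit \<open>A\<close> is not known to lie in \<open>G\<close>, so the
    inversion formula is carried over by continuity.\<close>
  have "(\<lambda>n. sp_inv (f n) ** f n) \<longlonglongrightarrow> sp_inv A ** A"
    by (intro tendsto_matrix_mult_3 tendsto_sp_inv f)
  then have "(\<lambda>n::nat. mat 1) \<longlonglongrightarrow> sp_inv A ** A"
    by (simp add: sp_inv_left in_Sp21 G)
  then have A: "sp_inv A ** A = mat 1"
    using LIMSEQ_unique tendsto_const by blast
  have lim: "(\<lambda>n. sp_inv (f n) ** f (Suc n)) \<longlonglongrightarrow> mat 1"
    unfolding A[symmetric] by (intro tendsto_matrix_mult_3 tendsto_sp_inv f LIMSEQ_Suc)
  obtain e where e: "e > 0" "\<And>B. B \<in> G \<Longrightarrow> dist (mat 1) B < e \<Longrightarrow> B = mat 1"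
    using discreteD[OF discrete_G one_closed] unfolding isolated_in_dist_Ex_iff by auto
  obtain N where N: "\<And>n. n \<ge> N \<Longrightarrow> dist (sp_inv (f n) ** f (Suc n)) (mat 1) < e"
    using tendstoD[OF lim e(1)] unfolding eventually_sequentially by auto
  have "f (Suc n) = f n" if "n \<ge> N" for n
  proof -
    have "sp_inv (f n) ** f (Suc n) = mat 1"
      using N[OF that] by (intro e mult_closed sp_inv_closed G) (simp add: dist_commute)
    then have "f n ** (sp_inv (f n) ** f (Suc n)) = f n" by simp
    then show ?thesis
      unfolding matrix_mul_assoc sp_inv_right[OF in_Sp21[OF G]] by simp
  qed
  then have "f (N + k) = f N" for k
    by (induction k) auto
  then have "(\<lambda>k. f (k + N)) \<longlonglongrightarrow> f N"
    by (simp add: add.commute)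
  then have "f N = A"
    using LIMSEQ_ignore_initial_segment[OF f(2)] LIMSEQ_unique by blast
  then show False using f(1)[of N] by auto
qed

lemma finite_bounded_corner:
  "finite {A \<in> G. norm (A$2$2) \<le> C \<and> norm (A$2$3) \<le> C \<and> norm (A$3$2) \<le> C \<and> norm (A$3$3) \<le> C}"
    (is "finite ?S")
proof (rule finite_if_bounded)
  \<comment> \<open>The four entries next to the corner have squares at most \<open>2 * C^2\<close>,
    hence moduli at most \<open>2 * C\<close>. The square of the first entry is then at most
    \<open>1 + 8 * C^2\<close>, and so at most the square of \<open>1 + 3 * C\<close>.\<close>
  have "norm (A $ i $ j) \<le> 1 + 3 * C" if A: "A \<in> ?S" for A i j
  proof -
    have C: "0 \<le> C" using that norm_ge_zero order_trans by blast
    have p: "norm x * norm y \<le> C * C" if "norm x \<le> C" "norm y \<le> C" for x y :: quat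
      using that C by (intro mult_mono) auto
    have sq: "x \<le> 2 * C" if "x\<^sup>2 \<le> 2 * (C * C)" for x :: real
    proof (rule power2_le_imp_le)
      have "0 \<le> C * C" "(2 * C)\<^sup>2 = 4 * (C * C)" using C by (simp_all add: power2_eq_square)
      then show "x\<^sup>2 \<le> (2 * C)\<^sup>2"
        using that by linarith
    qed (use C in simp)
    note b = Sp21_entry_bounds[OF in_Sp21, of A]
    have 1: "norm (A$2$1) \<le> 2 * C" "norm (A$3$1) \<le> 2 * C" "norm (A$1$2) \<le> 2 * C" "norm (A$1$3) \<le> 2 * C"
      using A by (auto intro!: sq order_trans[OF b(1)] order_trans[OF b(2)] order_trans[OF b(3)]
          order_trans[OF b(4)] p)
    have "norm (A$2$1) * norm (A$3$1) \<le> (2 * C) * (2 * C)"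
      by (intro mult_mono 1) (use C in auto)
    then have "(norm (A$1$1))\<^sup>2 \<le> 1 + 8 * (C * C)"
      using b(5) A by auto
    also have "\<dots> \<le> (1 + 3 * C)\<^sup>2"
      using C by (simp add: power2_eq_square algebra_simps)
    finally have "norm (A$1$1) \<le> 1 + 3 * C"
      by (rule power2_le_imp_le) (use C in simp)
    then have "\<forall>i j. norm (A $ i $ j) \<le> 1 + 3 * C"
      using 1 A C unfolding forall_3 by auto
    then show ?thesis by blast
  qed
  note entry = this
  have "norm A \<le> (\<Sum>i\<in>(UNIV::3 set). \<Sum>j\<in>(UNIV::3 set). 1 + 3 * C)" if "A \<in> ?S" for A
    by (rule order_trans[OF norm_vec_le_sum], rule sum_mono, rule order_trans[OF norm_vec_le_sum],
        rule sum_mono, rule entry, rule that)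
  then show "bounded ?S" by (meson boundedI)
qed auto

lemma finite_range_if_bounded_corner:
  fixes A :: "'i \<Rightarrow> quat^3^3"
  assumes "\<And>i. A i \<in> G" "\<And>i. norm (A i $2$2) \<le> C" "\<And>i. norm (A i $2$3) \<le> C"
    "\<And>i. norm (A i $3$2) \<le> C" "\<And>i. norm (A i $3$3) \<le> C"
  shows "finite (range A)"
  by (rule finite_subset[OF _ finite_bounded_corner[of C]]) (use assms in auto)

text \<open>All powers of such a matrix have corner entries of modulus at most 1, so only finitely
  many are distinct; two of them agree and \<open>A\<close> is a torsion element.\<close>

lemma eq_one_if_diag_unit:
  assumes A: "A \<in> G" and 0: "A$2$3 = 0" "A$3$2 = 0" and 1: "norm (A$2$2) = 1"
  shows "A = mat 1"
proof -
  note D = Sp21_diagI[OF in_Sp21[OF A] 0]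
  have "A [^]\<^bsub>Sp21\<^esub> n = diag3 (A$1$1 ^ n) (A$2$2 ^ n) (A$3$3 ^ n)" for n :: nat
    by (subst D(1)) (rule diag3_pow)
  then have "finite (range (\<lambda>n::nat. A [^]\<^bsub>Sp21\<^esub> n))"
    using D(3) 1 by (intro finite_range_if_bounded_corner[where C = 1] pow_closed A) (simp_all add: norm_power)
  then have "\<not> inj (\<lambda>n::nat. A [^]\<^bsub>Sp21\<^esub> n)"
    using finite_imageD infinite_UNIV_nat by blast
  then obtain m n :: nat where "m < n" "A [^]\<^bsub>Sp21\<^esub> n = A [^]\<^bsub>Sp21\<^esub> m"
    unfolding inj_def by (metis linorder_neqE_nat)
  then have "A [^]\<^bsub>Sp21\<^esub> (n - m) = \<one>\<^bsub>Sp21\<^esub>"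
    using group.pow_eq_div2[OF group_Sp21] in_Sp21[OF A] by simp
  then show ?thesis
    using torsion_free_G A \<open>m < n\<close> unfolding torsion_free_def by (metis one_Sp21 zero_less_diff)
qed

text \<open>An element exchanging the end points \<open>e\<^sub>2\<close>, \<open>e\<^sub>3\<close> of a geodesic has an elliptic square.\<close>
lemma not_swap:
  assumes A: "A \<in> G"
  shows "\<not> (A$2$2 = 0 \<and> A$3$3 = 0)"
proof
  assume 0: "A$2$2 = 0 \<and> A$3$3 = 0"
  then have 1: "A$2$1 = 0" "A$3$1 = 0" "A$1$2 = 0" "A$1$3 = 0"
    using Sp21_entry_bounds[OF in_Sp21[OF A]] by auto
  have "norm (A$2$3 * qcnj (A$3$2)) = 1"
    using Sp21_row_relations(3)[OF in_Sp21[OF A]] 0 1 by simp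
  then have "A ** A = mat 1"
    by (intro eq_one_if_diag_unit mult_closed A) (simp_all add: matrix_mult_3 norm_mult 0 1)
  then have "A [^]\<^bsub>Sp21\<^esub> (2::nat) = \<one>\<^bsub>Sp21\<^esub>"
    by (simp add: numeral_2_eq_2)
  then have "A = mat 1"
    using torsion_free_G A unfolding torsion_free_def by (metis one_Sp21 pos2)
  then show False using 0 by simp
qed

lemma finite_decay:
  assumes "finite (range (\<lambda>m::nat. x * t ^ m))" "t > 1"
  shows "x = (0::real)"
proof (rule ccontr)
  assume "x \<noteq> 0"
  then have "inj (\<lambda>m::nat. x * t ^ m)"
    using \<open>t > 1\<close> by (auto intro!: injI)
  then show False
    using assms(1) finite_imageD infinite_UNIV_nat by blast
qed

text \<open>Conjugation by powers of a loxodromic element contracts an element sharing exactly one fixed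
  point with it, so that a discrete group contains no such element.\<close>
lemma diag_if_common_fixed_point:
  assumes A: "A \<in> G" and D: "diag3 a b c \<in> G" and n: "norm b = L" "norm c = inverse L" "L > 1"
    and 0: "A$2$3 = 0 \<or> A$3$2 = 0"
  shows "A$2$3 = 0 \<and> A$3$2 = 0"
proof -
  define P where "P m = diag3 a b c [^]\<^bsub>Sp21\<^esub> m" for m :: nat
  have P: "P m = diag3 (a ^ m) (b ^ m) (c ^ m)" "P m \<in> G" "sp_inv (P m) \<in> G" for m
    unfolding P_def by (rule diag3_pow, (intro sp_inv_closed pow_closed D)+)
  have e: "L ^ m * inverse L ^ m = 1" "inverse L ^ m * L ^ m = 1" for m
    using n by (simp_all flip: power_mult_distrib)
  have L: "inverse L ^ m * inverse L ^ m \<le> 1" for m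
    using n by (intro mult_le_one power_le_one) (auto simp: inverse_le_1_iff)
  have L2: "inverse (inverse L ^ m * inverse L ^ m) = (L * L) ^ m" for m
    by (simp add: power_mult_distrib power_inverse)
  define C where "C = norm (A$2$2) + norm (A$2$3) + norm (A$3$2) + norm (A$3$3)"
  have C: "norm (A$2$2) \<le> C" "norm (A$2$3) \<le> C" "norm (A$3$2) \<le> C" "norm (A$3$3) \<le> C" "0 \<le> C"
    by (simp_all add: C_def)
  \<comment> \<open>Reciprocals turn the decaying sequence into a growing one, to which
    \<open>finite_decay\<close> applies.\<close>
  have decay: "x = 0" if "finite (range (\<lambda>m. norm (x::quat) * (inverse L ^ m * inverse L ^ m)))" for x
  proof (rule ccontr)
    assume "x \<noteq> 0"
    have "inverse ` range (\<lambda>m. norm x * (inverse L ^ m * inverse L ^ m)) = range (\<lambda>m. inverse (norm x) * (L * L) ^ m)"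
      unfolding image_image by (simp only: inverse_mult_distrib[of "norm x"] L2)
    with that have "finite (range (\<lambda>m. inverse (norm x) * (L * L) ^ m))"
      by (metis finite_imageI)
    moreover have "L * L > 1"
      using n(3) by (simp add: less_1_mult)
    ultimately have "inverse (norm x) = 0" by (rule finite_decay)
    with \<open>x \<noteq> 0\<close> show False by simp
  qed
  from 0 show ?thesis
  proof
    assume 0: "A$3$2 = 0"
    \<comment> \<open>The side of conjugation is chosen so that the remaining off-diagonal corner
      entry is scaled by \<open>L\<close> to the power \<open>-2 * m\<close>, while the diagonal
      moduli stay fixed. The second case uses the opposite side.\<close>
    define B where "B m = sp_inv (P m) ** A ** P m" for m
    have B: "norm (B m $2$2) = norm (A$2$2)" "norm (B m $3$3) = norm (A$3$3)"
      "norm (B m $2$3) = norm (A$2$3) * (inverse L ^ m * inverse L ^ m)" "B m $3$2 = 0" for m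
      using e[of m] by (simp_all add: B_def P(1) matrix_mult_3 norm_mult norm_power n 0)
    have "finite (range B)"
    proof (rule finite_range_if_bounded_corner[where C = C])
      show "B m \<in> G" for m unfolding B_def by (intro mult_closed P A)
      show "norm (B m $2$3) \<le> C" for m
        unfolding B using C(2) L[of m] by (metis mult_left_le norm_ge_zero order_trans)
    qed (use C in \<open>simp_all add: B\<close>)
    then have "finite ((\<lambda>X. norm (X$2$3)) ` range B)" by (rule finite_imageI)
    then have "A$2$3 = 0"
      unfolding image_image B by (rule decay)
    with 0 show ?thesis by simp
  next
    assume 0: "A$2$3 = 0"
    define B where "B m = P m ** A ** sp_inv (P m)" for m
    have B: "norm (B m $2$2) = norm (A$2$2)" "norm (B m $3$3) = norm (A$3$3)"
      "norm (B m $3$2) = norm (A$3$2) * (inverse L ^ m * inverse L ^ m)" "B m $2$3 = 0" for m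
      using e[of m] by (simp_all add: B_def P(1) matrix_mult_3 norm_mult norm_power n 0)
    have "finite (range B)"
    proof (rule finite_range_if_bounded_corner[where C = C])
      show "B m \<in> G" for m unfolding B_def by (intro mult_closed P A)
      show "norm (B m $3$2) \<le> C" for m
        unfolding B using C(3) L[of m] by (metis mult_left_le norm_ge_zero order_trans)
    qed (use C in \<open>simp_all add: B\<close>)
    then have "finite ((\<lambda>X. norm (X$3$2)) ` range B)" by (rule finite_imageI)
    then have "A$3$2 = 0"
      unfolding image_image B by (rule decay)
    with 0 show ?thesis by simp
  qed
qed

text \<open>If the conjugate \<open>d\<close> is diagonal, comparing moduli in
  \<open>d ** A = A ** diag3 a b c\<close> shows that rows 2 and 3 of \<open>A\<close> each have at
  most one nonzero entry in columns 2 and 3, because \<open>L\<close> and its inverse differ. The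
  antidiagonal pattern is ruled out by \<open>not_swap\<close>.\<close>

lemma diag_if_conj_diag:
  assumes A: "A \<in> G" and n: "norm a = 1" "norm b = L" "norm c = inverse L" "L > 1"
    and f: "diag3 a b c \<in> G"
    and 0: "(A ** diag3 a b c ** sp_inv A)$2$3 = 0" "(A ** diag3 a b c ** sp_inv A)$3$2 = 0"
  shows "A$2$3 = 0 \<and> A$3$2 = 0"
proof -
  define d where "d = A ** diag3 a b c ** sp_inv A"
  have d: "d \<in> G" unfolding d_def by (intro mult_closed sp_inv_closed A f)
  have "d ** A = A ** diag3 a b c ** (sp_inv A ** A)"
    unfolding d_def by (simp only: matrix_mul_assoc)
  then have eq: "d ** A = A ** diag3 a b c"
    unfolding sp_inv_left[OF in_Sp21[OF A]] by simp
  note dd = Sp21_diagI[OF in_Sp21[OF d] 0[folded d_def]]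
  have *: "norm (A$i$j) = 0 \<or> norm (d$i$i) = norm (diag3 a b c $j$j)" for i j
  proof -
    have "(d ** A)$i$j = d$i$i * A$i$j" "(A ** diag3 a b c)$i$j = A$i$j * diag3 a b c $j$j"
      by (subst dd(1), use exhaust_3[of i] in \<open>auto simp: matrix_mult_3\<close>)
        (use exhaust_3[of j] in \<open>auto simp: matrix_mult_3\<close>)
    then have "norm (d$i$i) * norm (A$i$j) = norm (A$i$j) * norm (diag3 a b c $j$j)"
      using eq by (metis norm_mult)
    then show ?thesis by auto
  qed
  have L: "L \<noteq> inverse L"
    using n by (metis inverse_less_1_iff less_asym' order.strict_trans zero_less_one)
  have 22: "A$2$2 = 0 \<or> A$2$3 = 0" and 33: "A$3$2 = 0 \<or> A$3$3 = 0"
    using *[of 2 2] *[of 2 3] *[of 3 2] *[of 3 3] n L by auto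
  then have 1: "A$2$1 = 0" "A$3$1 = 0"
    using Sp21_entry_bounds(1,2)[OF in_Sp21[OF A]] by auto
  then have "A$2$2 * qcnj (A$3$3) + A$2$3 * qcnj (A$3$2) = 1"
    using Sp21_row_relations(3)[OF in_Sp21[OF A]] by simp
  with 22 33 not_swap[OF A] show ?thesis by auto
qed

text \<open>On diagonal elements of \<open>G\<close> the modulus of the (2,2) entry is a
  homomorphism with trivial kernel by \<open>eq_one_if_diag_unit\<close>. Discreteness gives a least
  value above 1, so its bearer \<open>f\<close> generates; primitivity then gives
  \<open>f = g\<close>.\<close>

lemma diag_subgroup_cyclic:
  assumes g: "g \<in> G" "g$2$3 = 0" "g$3$2 = 0" "norm (g$2$2) > 1"
    and prim: "primitive_in G g"
    and A: "A \<in> G" "A$2$3 = 0" "A$3$2 = 0"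
  shows "A \<in> generate Sp21 {g}"
proof -
  define D where "D = {A \<in> G. A$2$3 = 0 \<and> A$3$2 = 0}"
  have D_mult: "A ** B \<in> D \<and> norm ((A ** B)$2$2) = norm (A$2$2) * norm (B$2$2)" if "A \<in> D" "B \<in> D" for A B
  proof -
    have A: "A = diag3 (A$1$1) (A$2$2) (A$3$3)" and B: "B = diag3 (B$1$1) (B$2$2) (B$3$3)"
      using that by (auto simp: D_def intro!: Sp21_diagI in_Sp21)
    have "A ** B = diag3 (A$1$1 * B$1$1) (A$2$2 * B$2$2) (A$3$3 * B$3$3)"
      by (subst A, subst B) (rule diag3_mult)
    moreover have "A ** B \<in> G"
      using that by (auto simp: D_def mult_closed)
    ultimately show ?thesis
      by (simp add: D_def norm_mult)
  qed
  have D_inv: "sp_inv A \<in> D \<and> norm (sp_inv A$2$2) = inverse (norm (A$2$2))" if "A \<in> D" for A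
    using that Sp21_diagI(3)[OF in_Sp21, of A] by (auto simp: D_def sp_inv_closed intro: inverse_unique[symmetric])
  have D_pow: "A [^]\<^bsub>Sp21\<^esub> n \<in> D \<and> norm ((A [^]\<^bsub>Sp21\<^esub> n)$2$2) = norm (A$2$2) ^ n" if "A \<in> D" for A and n :: nat
  proof (induction n)
    case 0
    then show ?case by (simp add: D_def one_closed)
  next
    case (Suc n)
    then show ?case using D_mult[of "A [^]\<^bsub>Sp21\<^esub> n" A] that by (simp add: mult.commute)
  qed
  define F where "F = {A \<in> D. 1 < norm (A$2$2) \<and> norm (A$2$2) \<le> norm (g$2$2)}"
  have "finite F"
  proof (rule finite_subset[OF _ finite_bounded_corner[of "norm (g$2$2)"]], safe)
    fix A assume A: "A \<in> F"
    then have "norm (A$3$3) = inverse (norm (A$2$2))"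
      using Sp21_diagI(3)[OF in_Sp21, of A] by (auto simp: F_def D_def intro: inverse_unique[symmetric])
    then have "norm (A$3$3) \<le> 1"
      using A by (auto simp: F_def inverse_le_1_iff)
    then show "norm (A$3$3) \<le> norm (g$2$2)"
      using g by simp
  qed (auto simp: F_def D_def)
  moreover have "g \<in> F" using g by (simp add: F_def D_def)
  ultimately obtain f where f: "f \<in> F" "\<And>B. B \<in> F \<Longrightarrow> norm (f$2$2) \<le> norm (B$2$2)"
    using ex_is_arg_min_if_finite[of F "\<lambda>A. norm (A$2$2)"] by (auto simp: is_arg_min_linorder)
  define t where "t = norm (f$2$2)"
  have fD: "f \<in> D" and t: "t > 1" using f by (auto simp: F_def t_def)
  have min: "norm (B$2$2) \<ge> t" if "B \<in> D" "norm (B$2$2) > 1" for B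
    using f(2)[of B] f(1) that unfolding F_def t_def by force
  have power: "\<exists>n::nat. B = f [^]\<^bsub>Sp21\<^esub> n" if B: "B \<in> D" "norm (B$2$2) \<ge> 1" for B
  proof -
    \<comment> \<open>This is the integer part of the logarithm of \<open>norm (B$2$2)\<close> to
      base \<open>t\<close>. The quotient \<open>E\<close> then has modulus at least 1 and less than
      \<open>t\<close>, hence 1 by minimality.\<close>
    define n where "n = (LEAST n. norm (B$2$2) < t ^ Suc n)"
    have "\<exists>n. norm (B$2$2) < t ^ Suc n"
      using real_arch_pow[OF t, of "norm (B$2$2)"] t by (metis lessI less_trans power_strict_increasing)
    then have n1: "norm (B$2$2) < t ^ Suc n"
      unfolding n_def by (rule LeastI_ex)
    have n2: "t ^ n \<le> norm (B$2$2)"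
    proof (cases n)
      case (Suc m)
      then show ?thesis
        using not_less_Least[of m "\<lambda>n. norm (B$2$2) < t ^ Suc n"] unfolding n_def by simp
    qed (use B in simp)
    define Q where "Q = f [^]\<^bsub>Sp21\<^esub> n"
    have Q: "Q \<in> D" "norm (Q$2$2) = t ^ n"
      using D_pow[OF fD, of n] by (simp_all add: Q_def t_def)
    define E where "E = B ** sp_inv Q"
    have E: "E \<in> D" "norm (E$2$2) = norm (B$2$2) / t ^ n"
      using D_mult[of B "sp_inv Q"] D_inv[OF Q(1)] B Q(2) by (simp_all add: E_def divide_inverse)
    have "norm (E$2$2) \<ge> 1" "norm (E$2$2) < t"
      using n1 n2 t by (simp_all add: E divide_simps mult.commute)
    then have "norm (E$2$2) = 1"
      using min[OF E(1)] by force
    then have "E = mat 1"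
      using E(1) by (intro eq_one_if_diag_unit) (auto simp: D_def)
    then have "B ** (sp_inv Q ** Q) = Q"
      unfolding E_def matrix_mul_assoc by simp
    then have "B = Q"
      using sp_inv_left[OF in_Sp21] Q(1) by (simp add: D_def)
    then show ?thesis unfolding Q_def by blast
  qed
  obtain n :: nat where n: "g = f [^]\<^bsub>Sp21\<^esub> n"
    using power[of g] g by (auto simp: D_def)
  have "n \<noteq> 0"
  proof
    assume "n = 0"
    then have "g = mat 1" using n by simp
    then show False using g(4) by simp
  qed
  moreover have "\<not> n \<ge> 2"
    using prim n fD unfolding primitive_in_def D_def by blast
  ultimately have "n = 1" by simp
  then have fg: "f = g" using n by simp
  interpret group Sp21 by (rule group_Sp21)
  have gen: "g [^]\<^bsub>Sp21\<^esub> k \<in> generate Sp21 {g}" for k :: nat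
    by (induction k) (use generate.one[of Sp21 "{g}"] generate.eng[of _ Sp21 "{g}" g] generate.incl[of g "{g}" Sp21] in auto)
  have AD: "A \<in> D" using A by (simp add: D_def)
  show ?thesis
  proof (cases "norm (A$2$2) \<ge> 1")
    case True
    then show ?thesis using power[OF AD] gen fg by auto
  next
    case False
    moreover have "norm (A$2$2) \<noteq> 0"
      using Sp21_diagI(3)[OF in_Sp21] A by fastforce
    ultimately have "norm (sp_inv A$2$2) \<ge> 1"
      using D_inv[OF AD] by (simp add: one_le_inverse_iff)
    then obtain k :: nat where "sp_inv A = g [^]\<^bsub>Sp21\<^esub> k"
      using power[of "sp_inv A"] D_inv[OF AD] fg by auto
    then have "inv\<^bsub>Sp21\<^esub> A \<in> generate Sp21 {g}"
      using gen[of k] inv_Sp21[OF in_Sp21[OF A(1)]] by simp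
    then have "inv\<^bsub>Sp21\<^esub> (inv\<^bsub>Sp21\<^esub> A) \<in> generate Sp21 {g}"
      using generate_m_inv_closed[of "{g}"] in_Sp21[OF g(1)] by simp
    then show ?thesis using in_Sp21[OF A(1)] by simp
  qed
qed

end

section \<open>Joergensen's inequality\<close>

text \<open>The sequence \<open>h\<^sub>0 = h\<close>, \<open>h\<^sub>k\<^sub>+\<^sub>1 = h\<^sub>k f h\<^sub>k\<^sup>-\<^sup>1\<close> stays in a bounded part of \<open>G\<close>, so it takes finitely many
  values, while \<open>cross_x h\<^sub>k\<close> is positive and tends to \<open>0\<close>.\<close>
lemma (in discrete_torsion_free) diag_if_cross_small:
  assumes f: "diag3 a b c \<in> G" and n: "norm a = 1" "norm b = L" "norm c = inverse L" "L > 1"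
    and M: "M = 2 * norm (a - 1) + norm (b - 1) + norm (c - 1)" and LM: "M * L < 1"
    and h: "h \<in> G" and small: "M * (cross_x h * cross_y h) < (1 - M) / M"
  shows "h$2$3 = 0 \<and> h$3$2 = 0"
proof (rule ccontr)
  assume nd: "\<not> (h$2$3 = 0 \<and> h$3$2 = 0)"
  define H where "H = rec_nat h (\<lambda>_ A. A ** diag3 a b c ** sp_inv A)"
  have H: "H 0 = h" "H (Suc k) = H k ** diag3 a b c ** sp_inv (H k)" for k
    by (simp_all add: H_def)
  have HG: "H k \<in> G" for k
    by (induction k) (simp_all add: H h mult_closed sp_inv_closed f)
  note HS = in_Sp21[OF HG]
  have nd: "\<not> (H k$2$3 = 0 \<and> H k$3$2 = 0)" for k
  proof (induction k)
    case (Suc k)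
    then show ?case
      using diag_if_conj_diag[OF HG n f, of k] unfolding H by blast
  qed (simp add: H nd)
  define x where "x k = cross_x (H k)" for k
  \<comment> \<open>One vanishing factor is enough for \<open>x k = 0\<close>;
    \<open>diag_if_common_fixed_point\<close> would make the other factor vanish too.\<close>
  have x_pos: "x k > 0" for k
  proof -
    have "H k$2$3 \<noteq> 0" "H k$3$2 \<noteq> 0"
      using diag_if_common_fixed_point[OF HG f n(2-4), of k] nd[of k] by auto
    then show ?thesis by (simp add: x_def cross_x_def)
  qed
  have "1 < norm b" using n by simp
  then have "0 < norm (b - 1)" by auto
  then have M0: "M > 0" unfolding M by (simp add: add_nonneg_pos add_pos_nonneg)
  have y: "cross_y (H k) \<le> 1 + x k" for k
    unfolding x_def by (rule cross_y_le[OF HS])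
  have step: "x (Suc k) \<le> M * (x k * cross_y (H k))" for k
    unfolding x_def H using cross_x_conj_diag3[OF HS M, of k] by simp
  \<comment> \<open>The hypothesis bounds the first iterate and not \<open>x 0\<close>, so the
    contraction starts at index 1. That \<open>x 1\<close> is below \<open>(1 - M) / M\<close> means
    that this factor is below 1.\<close>
  define \<kappa> where "\<kappa> = M * (1 + x 1)"
  have "x 1 < (1 - M) / M"
    using step[of 0] small by (simp add: H x_def)
  then have \<kappa>: "0 \<le> \<kappa>" "\<kappa> < 1"
    using M0 x_pos[of 1] by (simp_all add: \<kappa>_def field_simps)
  have decay: "x (Suc k) \<le> \<kappa> ^ k * x 1" for k
  proof (induction k)
    case (Suc k)
    have "\<kappa> ^ k * x 1 \<le> 1 * x 1"
      using \<kappa> x_pos[of 1] by (intro mult_right_mono power_le_one) auto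
    with Suc have "x (Suc k) \<le> x 1" by simp
    then have "M * (x (Suc k) * cross_y (H (Suc k))) \<le> M * (x (Suc k) * (1 + x 1))"
      using M0 x_pos[of "Suc k"] y[of "Suc k"] by (intro mult_left_mono) auto
    with step[of "Suc k"] have "x (Suc (Suc k)) \<le> \<kappa> * x (Suc k)"
      by (simp add: \<kappa>_def mult_ac)
    also have "\<dots> \<le> \<kappa> * (\<kappa> ^ k * x 1)"
      using \<kappa> Suc by (intro mult_left_mono) auto
    finally show ?case by (simp add: mult_ac)
  qed simp
  have lim: "x \<longlonglongrightarrow> 0"
  proof (rule LIMSEQ_imp_Suc, rule tendsto_sandwich)
    show "eventually (\<lambda>k. 0 \<le> x (Suc k)) sequentially"
      by (intro always_eventually allI less_imp_le x_pos)
    show "eventually (\<lambda>k. x (Suc k) \<le> \<kappa> ^ k * x 1) sequentially"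
      by (intro always_eventually allI decay)
    show "(\<lambda>k. \<kappa> ^ k * x 1) \<longlonglongrightarrow> 0"
      using \<kappa> by (intro tendsto_mult_left_zero LIMSEQ_power_zero) auto
  qed simp
  \<comment> \<open>By \<open>conj_diag3_diag\<close> and \<open>cross_y_le\<close> the diagonal
    entries are eventually almost bounded by \<open>L\<close>, so \<open>M * L < 1\<close> keeps
    \<open>M\<close> times them below 1.\<close>
  have "(\<lambda>k. M * (L * (1 + 2 * x k)\<^sup>2)) \<longlonglongrightarrow> M * (L * (1 + 2 * 0)\<^sup>2)"
    by (intro tendsto_intros lim)
  then have "eventually (\<lambda>k. M * (L * (1 + 2 * x k)\<^sup>2) < 1) sequentially"
    by (rule order_tendstoD) (use LM in simp)
  then obtain N where N: "\<And>k. k \<ge> N \<Longrightarrow> M * (L * (1 + 2 * x k)\<^sup>2) < 1"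
    unfolding eventually_sequentially by auto
  define B where "B k = H (Suc (N + k))" for k
  have diag: "M * norm (B k$2$2) \<le> 1" "M * norm (B k$3$3) \<le> 1" for k
  proof -
    have "(cross_x (H (N + k)) + cross_y (H (N + k)))\<^sup>2 \<le> (1 + 2 * x (N + k))\<^sup>2"
      using y[of "N + k"] by (intro power_mono) (auto simp: x_def)
    then have "L * (cross_x (H (N + k)) + cross_y (H (N + k)))\<^sup>2 \<le> L * (1 + 2 * x (N + k))\<^sup>2"
      using n by (intro mult_left_mono) auto
    then have "norm (B k$2$2) \<le> L * (1 + 2 * x (N + k))\<^sup>2" "norm (B k$3$3) \<le> L * (1 + 2 * x (N + k))\<^sup>2"
      using conj_diag3_diag[OF HS n(1-3) less_imp_le[OF n(4)], of "N + k"] unfolding B_def H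
      by - (linarith+)
    then have "M * norm (B k$2$2) \<le> M * (L * (1 + 2 * x (N + k))\<^sup>2)"
      "M * norm (B k$3$3) \<le> M * (L * (1 + 2 * x (N + k))\<^sup>2)"
      using M0 by simp_all
    then show "M * norm (B k$2$2) \<le> 1" "M * norm (B k$3$3) \<le> 1"
      using N[of "N + k"] by linarith+
  qed
  \<comment> \<open>Smallness of the product of the two off-diagonal entries would not bound each of
    them. Here each is nonincreasing along the tail, because its growth factor is \<open>M\<close>
    times a diagonal entry.\<close>
  have off: "norm (B (Suc k)$2$3) \<le> norm (B k$2$3)" "norm (B (Suc k)$3$2) \<le> norm (B k$3$2)" for k
  proof -
    have "norm (B (Suc k)$2$3) \<le> (M * norm (B k$2$2)) * norm (B k$2$3)"
      "norm (B (Suc k)$3$2) \<le> (M * norm (B k$3$3)) * norm (B k$3$2)"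
      using conj_diag3_off[OF HS, of "Suc (N + k)" a b c] unfolding B_def M by (simp_all add: H mult_ac)
    then show "norm (B (Suc k)$2$3) \<le> norm (B k$2$3)" "norm (B (Suc k)$3$2) \<le> norm (B k$3$2)"
      using mult_right_mono[OF diag(1)[of k], of "norm (B k$2$3)"]
        mult_right_mono[OF diag(2)[of k], of "norm (B k$3$2)"] by simp_all
  qed
  have off0: "norm (B k$2$3) \<le> norm (B 0$2$3)" "norm (B k$3$2) \<le> norm (B 0$3$2)" for k
    by (induction k) (auto intro: order_trans[OF off(1)] order_trans[OF off(2)])
  define C where "C = 1 / M + norm (B 0$2$3) + norm (B 0$3$2)"
  have "finite (range B)"
  proof (rule finite_range_if_bounded_corner[where C = C])
    show "B k \<in> G" for k by (simp add: B_def HG)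
    have "norm (B k$2$2) \<le> 1 / M" "norm (B k$3$3) \<le> 1 / M" for k
      using diag[of k] M0 by (simp_all add: field_simps)
    then show "norm (B k$2$2) \<le> C" "norm (B k$3$3) \<le> C" for k
      unfolding C_def using norm_ge_zero[of "B 0$2$3"] norm_ge_zero[of "B 0$3$2"]
      by (meson add_increasing2 order_trans)+
    show "norm (B k$2$3) \<le> C" "norm (B k$3$2) \<le> C" for k
      unfolding C_def using off0[of k] zero_le_divide_1_iff[of M] M0
        norm_ge_zero[of "B 0$2$3"] norm_ge_zero[of "B 0$3$2"]
      by - (linarith+)
  qed
  then have fin: "finite (cross_x ` range B)" by simp
  \<comment> \<open>Finitely many positive values have a positive minimum, which is incompatible
    with convergence to 0.\<close>
  define m where "m = Min (cross_x ` range B)"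
  have "m \<in> cross_x ` range B"
    unfolding m_def using fin by (intro Min_in) auto
  then have "m > 0" using x_pos by (auto simp: B_def x_def)
  moreover have "m \<le> x (k + Suc N)" for k
    unfolding m_def using fin by (intro Min_le) (auto simp: x_def B_def add.commute)
  moreover have "(\<lambda>k. x (k + Suc N)) \<longlonglongrightarrow> 0"
    using lim by (rule LIMSEQ_ignore_initial_segment)
  ultimately show False
    using LIMSEQ_le_const[of "\<lambda>k. x (k + Suc N)" 0 m] by force
qed

section \<open>The hyperbolic metric\<close>

definition vscale :: "quat^3 \<Rightarrow> quat \<Rightarrow> quat^3" where
  "vscale z q = (\<chi> i. z $ i * q)"

lemma vscale_nth [simp]: "vscale z q $ i = z $ i * q"
  by (simp add: vscale_def)

lemma vscale_vscale: "vscale (vscale z p) q = vscale z (p * q)"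
  by (simp add: vec_eq_iff mult.assoc)

lemma vscale_one [simp]: "vscale z 1 = z"
  by (simp add: vec_eq_iff)

lemma mult_vscale: "A *v vscale z q = vscale (A *v z) q"
  by (simp add: vec_eq_iff matrix_vector_mult_3 algebra_simps mult.assoc)

lemma proj_eq: "proj z = {vscale z q |q. q \<noteq> 0}"
  by (simp add: proj_def vscale_def)

lemma self_in_proj: "z \<in> proj z"
  unfolding proj_eq using vscale_one[of z] by (metis (mono_tags, lifting) mem_Collect_eq one_neq_zero)

lemma proj_vscale:
  assumes "q \<noteq> 0"
  shows "proj (vscale z q) = proj z"
proof -
  have "vscale z p \<in> proj (vscale z q)" if "p \<noteq> 0" for p
  proof -
    have "vscale z p = vscale (vscale z q) (inverse q * p)"
      using assms by (simp add: vscale_vscale mult.assoc[symmetric])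
    then show ?thesis
      using that assms unfolding proj_eq by auto
  qed
  then show ?thesis
    using assms unfolding proj_eq by (auto simp: vscale_vscale)
qed

lemma act_proj: "act A (proj z) = proj (A *v z)"
  unfolding act_def proj_eq setcompr_eq_image image_image mult_vscale ..

section \<open>The Hermitian form, its signature and orthogonal projection\<close>

lemma herm_simps:
  "herm (z + z') w = herm z w + herm z' w" "herm z (w + w') = herm z w + herm z w'"
  "herm (z - z') w = herm z w - herm z' w" "herm z (w - w') = herm z w - herm z w'"
  "herm (vscale z q) w = herm z w * q" "herm z (vscale w q) = qcnj q * herm z w"
  by (simp_all add: herm_def algebra_simps mult.assoc)

lemma herm_swap: "herm w z = qcnj (herm z w)"
  by (simp add: herm_def algebra_simps)

lemma herm_self: "herm z z = of_real (qre (herm z z))"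
  unfolding quat_eq_iff by (simp add: herm_def quat_sel_mult)

lemma norm_herm_swap: "norm (herm w z) = norm (herm z w)"
  by (subst herm_swap) simp

lemma tendsto_herm:
  assumes "(f \<longlongrightarrow> z) F" "(g \<longlongrightarrow> w) F"
  shows "((\<lambda>x. herm (f x) (g x)) \<longlongrightarrow> herm z w) F"
  unfolding herm_def by (intro tendsto_intros tendsto_qcnj assms)

text \<open>The coordinates \<open>z$2 - z$3\<close> and \<open>z$2 + z$3\<close> diagonalise the
  form and exhibit its signature (2,1).\<close>

lemma herm_polar:
  "2 * herm z w = 2 * qcnj (w$1) * z$1 + qcnj (w$2 - w$3) * (z$2 - z$3) - qcnj (w$2 + w$3) * (z$2 + z$3)"
  by (simp add: herm_def algebra_simps mult_2 mult_2_right)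

lemma qre_herm_polar:
  "2 * qre (herm z z) = 2 * (norm (z$1))\<^sup>2 + (norm (z$2 - z$3))\<^sup>2 - (norm (z$2 + z$3))\<^sup>2"
  unfolding quat_norm_sq by (simp add: herm_def quat_sel_mult power2_eq_square algebra_simps)

text \<open>Let \<open>p\<close>, \<open>q\<close> be the lengths of the positive and negative parts
  of \<open>w\<close>, and \<open>p'\<close>, \<open>q'\<close> those of \<open>y\<close>.
  Orthogonality and the Cauchy-Schwarz inequality give \<open>q * q' \<le> p * p'\<close>, while
  \<open>p < q\<close>; hence \<open>q' \<le> p'\<close>.\<close>

lemma herm_orth_nonneg:
  assumes w: "w \<in> V_neg" and 0: "herm y w = 0"
  shows "qre (herm y y) \<ge> 0"
proof -
  define p q where "p = sqrt (2 * (norm (w$1))\<^sup>2 + (norm (w$2 - w$3))\<^sup>2)" and "q = norm (w$2 + w$3)"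
  define p' q' where "p' = sqrt (2 * (norm (y$1))\<^sup>2 + (norm (y$2 - y$3))\<^sup>2)" and "q' = norm (y$2 + y$3)"
  have p2: "p\<^sup>2 = 2 * (norm (w$1))\<^sup>2 + (norm (w$2 - w$3))\<^sup>2" "p'\<^sup>2 = 2 * (norm (y$1))\<^sup>2 + (norm (y$2 - y$3))\<^sup>2"
    and p0: "p \<ge> 0" "p' \<ge> 0" "q' \<ge> 0" "q \<ge> 0"
    by (simp_all add: p_def p'_def q_def q'_def)
  have "p\<^sup>2 < q\<^sup>2"
    using w qre_herm_polar[of w] unfolding V_neg_def p2 q_def by auto
  then have pq: "p < q" using p0 by (simp add: power_less_imp_less_base)
  have "2 * herm y w = 0" using 0 by simp
  then have "qcnj (w$2 + w$3) * (y$2 + y$3) = 2 * qcnj (w$1) * y$1 + qcnj (w$2 - w$3) * (y$2 - y$3)"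
    unfolding herm_polar by simp
  then have "q * q' = norm (2 * qcnj (w$1) * y$1 + qcnj (w$2 - w$3) * (y$2 - y$3))"
    unfolding q_def q'_def by (metis norm_mult norm_qcnj)
  also have "\<dots> \<le> norm (2 * qcnj (w$1) * y$1) + norm (qcnj (w$2 - w$3) * (y$2 - y$3))"
    by (rule norm_triangle_ineq)
  also have "\<dots> = 2 * norm (w$1) * norm (y$1) + norm (w$2 - w$3) * norm (y$2 - y$3)"
    unfolding norm_mult norm_qcnj by simp
  also have "\<dots> \<le> p * p'"
  proof (rule power2_le_imp_le)
    have *: "(2 * a * b + c * d)\<^sup>2 \<le> (2 * a\<^sup>2 + c\<^sup>2) * (2 * b\<^sup>2 + d\<^sup>2)" for a b c d :: real
    proof -
      have "(2 * a\<^sup>2 + c\<^sup>2) * (2 * b\<^sup>2 + d\<^sup>2) - (2 * a * b + c * d)\<^sup>2 = 2 * (a * d - b * c)\<^sup>2"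
        by (simp add: power2_eq_square algebra_simps)
      moreover have "0 \<le> 2 * (a * d - b * c)\<^sup>2" by simp
      ultimately show ?thesis by linarith
    qed
    show "(2 * norm (w$1) * norm (y$1) + norm (w$2 - w$3) * norm (y$2 - y$3))\<^sup>2 \<le> (p * p')\<^sup>2"
      unfolding power_mult_distrib p2 by (rule *)
  qed (use p0 in simp)
  also have "\<dots> \<le> q * p'"
    using pq p0 by (intro mult_right_mono) auto
  finally have "q' \<le> p'" using pq p0 by simp
  then have "q'\<^sup>2 \<le> p'\<^sup>2" using p0 by (intro power_mono)
  then show ?thesis
    using qre_herm_polar[of y] unfolding p2 q'_def by simp
qed

text \<open>This is the component of \<open>y\<close> orthogonal to \<open>x\<close>. As
  \<open>herm x x\<close> is real, a real scalar can stand for its inverse.\<close>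

definition orth :: "quat^3 \<Rightarrow> quat^3 \<Rightarrow> quat^3" where
  "orth x y = y - vscale x (of_real (1 / qre (herm x x)) * herm y x)"

lemma herm_orth:
  assumes "x \<in> V_neg"
  shows "herm (orth x y) x = 0"
    and "herm (orth x y) (orth x z) = herm y z - of_real (1 / qre (herm x x)) * (herm x z * herm y x)"
proof -
  have "herm x x * of_real (1 / qre (herm x x)) = 1"
    by (subst herm_self) (use assms in \<open>simp add: V_neg_def flip: of_real_mult\<close>)
  then show 0: "herm (orth x y) x = 0" for y
    by (simp add: orth_def herm_simps mult.assoc[symmetric] del: of_real_divide)
  have "herm (orth x y) (orth x z) = herm (orth x y) z"
    unfolding orth_def[of x z] herm_simps 0 by simp
  also have "\<dots> = herm y z - herm x z * (of_real (1 / qre (herm x x)) * herm y x)"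
    by (simp add: orth_def herm_simps)
  finally show "herm (orth x y) (orth x z) = herm y z - of_real (1 / qre (herm x x)) * (herm x z * herm y x)"
    by (metis mult.assoc quat_of_real_commute)
qed

lemma qre_herm_orth:
  assumes "x \<in> V_neg"
  shows "qre (herm (orth x y) (orth x y)) = qre (herm y y) - (norm (herm x y))\<^sup>2 / qre (herm x x)"
proof -
  have "herm x y * herm y x = of_real ((norm (herm x y))\<^sup>2)"
    by (subst herm_swap[of y x]) (rule mult_qcnj)
  then show ?thesis
    unfolding herm_orth(2)[OF assms] by (simp del: of_real_divide of_real_power add: quat_sel_mult)
qed

lemma reverse_cauchy_schwarz:
  assumes "x \<in> V_neg" "y \<in> V_neg"
  shows "qre (herm x x) * qre (herm y y) \<le> (norm (herm x y))\<^sup>2"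
proof -
  have "0 \<le> qre (herm y y) - (norm (herm x y))\<^sup>2 / qre (herm x x)"
    using herm_orth_nonneg[OF assms(1) herm_orth(1)[OF assms(1)], of y] qre_herm_orth[OF assms(1)] by simp
  then show ?thesis
    using assms(1) by (simp add: V_neg_def field_simps)
qed

text \<open>The form is nonnegative on the complement of \<open>x\<close>, so the usual quadratic
  polynomial argument works; the case of vanishing \<open>herm y y\<close> is treated
  separately.\<close>

lemma cauchy_schwarz_orth:
  assumes x: "x \<in> V_neg" and y: "herm y x = 0" and z: "herm z x = 0"
  shows "(norm (herm y z))\<^sup>2 \<le> qre (herm y y) * qre (herm z z)"
proof -
  define N where "N = (norm (herm y z))\<^sup>2"
  have N0: "N \<ge> 0" by (simp add: N_def)
  have hz: "0 \<le> qre (herm z z)" and hy: "0 \<le> qre (herm y y)"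
    using herm_orth_nonneg[OF x] y z by auto
  have q: "0 \<le> a\<^sup>2 * qre (herm y y) - 2 * a * N + qre (herm z z) * N" for a :: real
  proof -
    \<comment> \<open>Scaling \<open>z\<close> by \<open>herm y z\<close> makes the mixed terms
      real, so a real parameter \<open>a\<close> suffices.\<close>
    define v where "v = vscale y (of_real a) - vscale z (herm y z)"
    have zy: "herm z y = qcnj (herm y z)" by (rule herm_swap)
    have "herm v x = 0" by (simp add: v_def herm_simps y z)
    then have "0 \<le> qre (herm v v)" by (rule herm_orth_nonneg[OF x])
    also have "herm v v = of_real a * herm y y * of_real a - qcnj (herm y z) * herm y z * of_real a
      - of_real a * (qcnj (herm y z) * herm y z) + qcnj (herm y z) * herm z z * herm y z"
      unfolding v_def herm_simps zy by (simp add: algebra_simps mult.assoc zy)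
    also have "qcnj (herm y z) * herm z z * herm y z = herm z z * (qcnj (herm y z) * herm y z)"
      using herm_self[of z] by (metis mult.assoc quat_of_real_commute)
    also have "of_real a * herm y y * of_real a - qcnj (herm y z) * herm y z * of_real a
        - of_real a * (qcnj (herm y z) * herm y z) + herm z z * (qcnj (herm y z) * herm y z)
      = of_real (a * qre (herm y y) * a - N * a - a * N + qre (herm z z) * N)"
      unfolding mult_qcnj N_def[symmetric] of_real_mult of_real_add of_real_diff herm_self[symmetric] ..
    also have "qre \<dots> = a * qre (herm y y) * a - N * a - a * N + qre (herm z z) * N"
      by (rule quat_sel_of_real)
    finally show ?thesis by (simp add: power2_eq_square algebra_simps)
  qed
  show ?thesis
  proof (cases "qre (herm y y) = 0")
    case True
    \<comment> \<open>With a linear polynomial, the two values \<open>a = qre (herm z z)\<close> and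
      \<open>a = 1\<close> already force \<open>N\<close> to vanish.\<close>
    then have "qre (herm z z) * N \<le> 0"
      using q[of "qre (herm z z)"] by (simp add: mult.commute)
    moreover have "0 \<le> - 2 * N + qre (herm z z) * N"
      using q[of 1] True by simp
    ultimately have "N \<le> 0" by linarith
    then show ?thesis using True by (simp add: N_def)
  next
    case False
    then have pos: "qre (herm y y) > 0" using hy by simp
    have "0 \<le> (N / qre (herm y y))\<^sup>2 * qre (herm y y) - 2 * (N / qre (herm y y)) * N + qre (herm z z) * N"
      by (rule q)
    also have "\<dots> = N * (qre (herm z z) - N / qre (herm y y))"
      using pos by (simp add: power2_eq_square field_simps)
    finally have "N = 0 \<or> 0 \<le> qre (herm z z) - N / qre (herm y y)"
      using N0 by (auto simp: zero_le_mult_iff)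
    then show ?thesis
      using pos hz unfolding N_def[symmetric] by (auto simp: field_simps)
  qed
qed

section \<open>The distance expressed by lifts\<close>

lemma herm_vscale_self: "herm (vscale z q) (vscale z q) = of_real ((norm q)\<^sup>2 * qre (herm z z))"
proof -
  have "herm (vscale z q) (vscale z q) = qcnj q * of_real (qre (herm z z)) * q"
    by (simp add: herm_simps mult.assoc flip: herm_self)
  also have "\<dots> = (qcnj q * q) * of_real (qre (herm z z))"
    by (metis mult.assoc quat_of_real_commute)
  finally show ?thesis by (simp only: mult_qcnj of_real_mult)
qed

lemma V_neg_vscale: "z \<in> V_neg \<Longrightarrow> q \<noteq> 0 \<Longrightarrow> vscale z q \<in> V_neg"
  unfolding V_neg_def mem_Collect_eq herm_vscale_self quat_sel_of_real by (simp add: mult_less_0_iff)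

lemma herm_ratio_vscale:
  assumes "p \<noteq> 0" "q \<noteq> 0"
  shows "herm (vscale z p) (vscale w q) * herm (vscale w q) (vscale z p)
      / (herm (vscale z p) (vscale z p) * herm (vscale w q) (vscale w q))
    = of_real ((norm (herm z w))\<^sup>2 / (qre (herm z z) * qre (herm w w)))"
proof -
  have "herm (vscale z p) (vscale w q) * herm (vscale w q) (vscale z p)
    = of_real ((norm (herm (vscale z p) (vscale w q)))\<^sup>2)"
    by (subst (2) herm_swap) (rule mult_qcnj)
  also have "norm (herm (vscale z p) (vscale w q)) = norm q * norm (herm z w) * norm p"
    by (simp add: herm_simps norm_mult)
  finally show ?thesis
    unfolding herm_vscale_self using assms by (simp add: power_mult_distrib field_simps flip: of_real_mult of_real_divide)
qed

text \<open>The definite description is justified here: the quotient does not depend on the lifts,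
  it is at least 1 by \<open>reverse_cauchy_schwarz\<close>, and cosh is injective on nonnegative
  reals.\<close>

lemma rho_proj:
  assumes z: "z \<in> V_neg" and w: "w \<in> V_neg"
  shows "rho (proj z) (proj w) \<ge> 0"
    and "(cosh (rho (proj z) (proj w) / 2))\<^sup>2 = (norm (herm z w))\<^sup>2 / (qre (herm z z) * qre (herm w w))"
proof -
  define v where "v = (norm (herm z w))\<^sup>2 / (qre (herm z z) * qre (herm w w))"
  have pos: "qre (herm z z) * qre (herm w w) > 0"
    using z w by (simp add: V_neg_def mult_neg_neg)
  have "v \<ge> 1"
    using reverse_cauchy_schwarz[OF z w] pos by (simp add: v_def)
  have iff: "(\<forall>z'\<in>proj z. \<forall>w'\<in>proj w. of_real ((cosh (d / 2))\<^sup>2) = (herm z' w' * herm w' z') / (herm z' z' * herm w' w'))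
    \<longleftrightarrow> (cosh (d / 2))\<^sup>2 = v" for d :: real
  proof
    assume "(cosh (d / 2))\<^sup>2 = v"
    then show "\<forall>z'\<in>proj z. \<forall>w'\<in>proj w. of_real ((cosh (d / 2))\<^sup>2) = (herm z' w' * herm w' z') / (herm z' z' * herm w' w')"
      unfolding proj_eq using herm_ratio_vscale[of _ _ z w] by (auto simp: v_def)
  next
    assume "\<forall>z'\<in>proj z. \<forall>w'\<in>proj w. of_real ((cosh (d / 2))\<^sup>2) = (herm z' w' * herm w' z') / (herm z' z' * herm w' w')"
    then have "(of_real ((cosh (d / 2))\<^sup>2) :: quat) = (herm z w * herm w z) / (herm z z * herm w w)"
      using self_in_proj by blast
    also have "\<dots> = of_real v"
      using herm_ratio_vscale[of 1 1 z w] unfolding v_def vscale_one by simp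
    finally show "(cosh (d / 2))\<^sup>2 = v" unfolding of_real_eq_iff .
  qed
  have "\<exists>!d. d \<ge> 0 \<and> (cosh (d / 2))\<^sup>2 = v"
  proof (rule ex1I)
    show "0 \<le> 2 * arcosh (sqrt v) \<and> (cosh (2 * arcosh (sqrt v) / 2))\<^sup>2 = v"
      using \<open>v \<ge> 1\<close> by simp
  next
    fix d assume d: "0 \<le> d \<and> (cosh (d / 2))\<^sup>2 = v"
    then have "sqrt v = cosh (d / 2)"
      by (auto simp: real_sqrt_unique)
    then show "d = 2 * arcosh (sqrt v)"
      using d by (simp add: arcosh_cosh_real)
  qed
  then have "0 \<le> rho (proj z) (proj w) \<and> (cosh (rho (proj z) (proj w) / 2))\<^sup>2 = v"
    unfolding rho_def iff by (rule theI')
  then show "rho (proj z) (proj w) \<ge> 0"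
    "(cosh (rho (proj z) (proj w) / 2))\<^sup>2 = (norm (herm z w))\<^sup>2 / (qre (herm z z) * qre (herm w w))"
    by (simp_all add: v_def)
qed

lemma norm_herm_rho:
  assumes z: "z \<in> V_neg" and w: "w \<in> V_neg"
  shows "norm (herm z w) = cosh (rho (proj z) (proj w) / 2) * sqrt (qre (herm z z) * qre (herm w w))"
proof -
  have pos: "qre (herm z z) * qre (herm w w) > 0"
    using z w by (simp add: V_neg_def mult_neg_neg)
  have "(norm (herm z w))\<^sup>2 = (cosh (rho (proj z) (proj w) / 2))\<^sup>2 * (qre (herm z z) * qre (herm w w))"
    using rho_proj(2)[OF z w] unfolding nonzero_eq_divide_eq[OF less_imp_neq[OF pos, symmetric]]
    by (rule sym)
  then have "sqrt ((norm (herm z w))\<^sup>2) = sqrt ((cosh (rho (proj z) (proj w) / 2))\<^sup>2 * (qre (herm z z) * qre (herm w w)))"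
    by simp
  then show ?thesis by (simp add: real_sqrt_mult)
qed

text \<open>Split \<open>herm y z\<close> into the part orthogonal to \<open>x\<close> and the part
  along \<open>x\<close>. With \<open>a\<close>, \<open>b\<close> half the distances from
  \<open>x\<close>, the normalised moduli are at most \<open>sinh a * sinh b\<close> and equal to
  \<open>cosh a * cosh b\<close>, which add up to \<open>cosh (a + b)\<close>.\<close>

lemma rho_triangle:
  assumes x: "x \<in> V_neg" and y: "y \<in> V_neg" and z: "z \<in> V_neg"
  shows "rho (proj y) (proj z) \<le> rho (proj x) (proj y) + rho (proj x) (proj z)"
proof -
  define X Y Z where "X = - qre (herm x x)" and "Y = - qre (herm y y)" and "Z = - qre (herm z z)"
  have pos: "X > 0" "Y > 0" "Z > 0"
    using x y z by (simp_all add: X_def Y_def Z_def V_neg_def)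
  define a b where "a = rho (proj x) (proj y) / 2" and "b = rho (proj x) (proj z) / 2"
  have ab: "a \<ge> 0" "b \<ge> 0"
    using rho_proj(1) x y z by (simp_all add: a_def b_def)
  have hxy: "norm (herm x y) = cosh a * sqrt (X * Y)" and hxz: "norm (herm x z) = cosh b * sqrt (X * Z)"
    and hyz: "norm (herm y z) = cosh (rho (proj y) (proj z) / 2) * sqrt (Y * Z)"
    using norm_herm_rho x y z by (simp_all add: a_def b_def X_def Y_def Z_def)
  have o: "qre (herm (orth x y) (orth x y)) = Y * (sinh a)\<^sup>2" "qre (herm (orth x z) (orth x z)) = Z * (sinh b)\<^sup>2"
    unfolding qre_herm_orth[OF x] hxy hxz using pos
    by (simp_all add: power_mult_distrib sinh_square_eq algebra_simps flip: X_def) (simp_all add: X_def Y_def Z_def)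
  have "herm y z = herm (orth x y) (orth x z) - of_real (1 / X) * (herm x z * herm y x)"
    unfolding herm_orth(2)[OF x] by (simp add: X_def)
  then have "norm (herm y z) \<le> norm (herm (orth x y) (orth x z)) + norm (of_real (1 / X) * (herm x z * herm y x))"
    by (metis norm_triangle_ineq4)
  also have "norm (of_real (1 / X) * (herm x z * herm y x)) = cosh b * cosh a * sqrt (Y * Z)"
    unfolding norm_mult norm_of_real norm_herm_swap[of y x] hxy hxz using pos
    by (simp add: real_sqrt_mult field_simps)
  also have "norm (herm (orth x y) (orth x z)) \<le> sinh a * sinh b * sqrt (Y * Z)"
  proof (rule power2_le_imp_le)
    have "(norm (herm (orth x y) (orth x z)))\<^sup>2 \<le> (Y * (sinh a)\<^sup>2) * (Z * (sinh b)\<^sup>2)"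
      unfolding o[symmetric] by (intro cauchy_schwarz_orth[OF x] herm_orth x)
    also have "\<dots> = (sinh a * sinh b * sqrt (Y * Z))\<^sup>2"
      using pos by (simp add: power_mult_distrib)
    finally show "(norm (herm (orth x y) (orth x z)))\<^sup>2 \<le> (sinh a * sinh b * sqrt (Y * Z))\<^sup>2" .
  qed (use ab pos in simp)
  finally have "cosh (rho (proj y) (proj z) / 2) * sqrt (Y * Z) \<le> cosh (a + b) * sqrt (Y * Z)"
    unfolding hyz cosh_add by (simp add: algebra_simps)
  then have "cosh (rho (proj y) (proj z) / 2) \<le> cosh (a + b)"
    using pos by simp
  then have "rho (proj y) (proj z) / 2 \<le> a + b"
    using rho_proj(1)[OF y z] ab by (simp add: cosh_real_nonneg_le_iff)
  then show ?thesis by (simp add: a_def b_def)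
qed

section \<open>The action by isometries\<close>

lemma Sp21_herm: "A \<in> Sp21_set \<Longrightarrow> herm (A *v z) (A *v w) = herm z w"
  by (simp add: Sp21_set_def)

lemma Sp21_V_neg: "A \<in> Sp21_set \<Longrightarrow> z \<in> V_neg \<Longrightarrow> A *v z \<in> V_neg"
  by (simp add: V_neg_def Sp21_herm)

lemma rho_act:
  assumes A: "A \<in> Sp21_set" and z: "z \<in> V_neg" and w: "w \<in> V_neg"
  shows "rho (act A (proj z)) (act A (proj w)) = rho (proj z) (proj w)"
proof -
  note AV = Sp21_V_neg[OF A z] Sp21_V_neg[OF A w]
  have "sqrt (qre (herm z z) * qre (herm w w)) > 0"
    using z w by (intro real_sqrt_gt_zero) (simp add: V_neg_def mult_neg_neg)
  then have "cosh (rho (proj (A *v z)) (proj (A *v w)) / 2) = cosh (rho (proj z) (proj w) / 2)"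
    using norm_herm_rho[OF AV] norm_herm_rho[OF z w] unfolding Sp21_herm[OF A]
    by (metis less_irrefl mult_right_cancel)
  then show ?thesis
    unfolding act_proj using rho_proj(1)[OF AV] rho_proj(1)[OF z w] by simp
qed

lemma hyp_space_lift:
  assumes "p \<in> hyp_space" "z \<in> p"
  shows "z \<in> V_neg" "p = proj z"
proof -
  obtain w q where "w \<in> V_neg" "p = proj w" "z = vscale w q" "q \<noteq> 0"
    using assms unfolding hyp_space_def proj_eq by auto
  then show "z \<in> V_neg" "p = proj z"
    by (simp_all add: V_neg_vscale proj_vscale)
qed

section \<open>The axis\<close>

text \<open>For positive \<open>t\<close> these vectors lie over the geodesic between e3
  (\<open>t\<close> tending to 0) and e2 (\<open>t\<close> tending to infinity).\<close>

definition axis_point :: "real \<Rightarrow> quat^3" where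
  "axis_point t = vector [0, of_real t, 1]"

lemma axis_point_nth [simp]:
  "axis_point t $ 1 = 0" "axis_point t $ 2 = of_real t" "axis_point t $ 3 = 1"
  by (simp_all add: axis_point_def)

lemma qre_herm_axis_point: "qre (herm (axis_point t) (axis_point t)) = - 2 * t"
  by (simp add: herm_def)

lemma axis_point_V_neg: "t > 0 \<Longrightarrow> axis_point t \<in> V_neg"
  unfolding V_neg_def mem_Collect_eq qre_herm_axis_point by simp

lemma cosh_half_mult: "cosh ((x - y) / 2) * cosh ((x + y) / 2) = (cosh x + cosh y) / 2" for x y :: real
proof -
  have "cosh x = cosh ((x + y) / 2 + (x - y) / 2)" "cosh y = cosh ((x + y) / 2 - (x - y) / 2)"
    by (simp_all add: field_simps)
  then show ?thesis unfolding cosh_add cosh_diff by (simp add: mult.commute)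
qed

lemma inverse_cosh_tendsto: "((\<lambda>x::real. c / cosh x) \<longlongrightarrow> 0) at_top"
proof (rule tendsto_divide_0[OF tendsto_const])
  have "filterlim (cosh :: real \<Rightarrow> real) at_top at_top"
    by (rule cosh_real_at_top)
  then show "filterlim (cosh :: real \<Rightarrow> real) at_infinity at_top"
    by (rule filterlim_at_top_imp_at_infinity)
qed

text \<open>The distances from \<open>c s\<close> to \<open>c T\<close> and to \<open>c (- T)\<close> are \<open>T - s\<close> and \<open>T + s\<close>;
  let \<open>T\<close> tend to infinity.\<close>
lemma geodesic_end_points:
  fixes c :: "real \<Rightarrow> (quat^3) set"
  assumes hyp: "range c \<subseteq> hyp_space" and iso: "\<And>s t. rho (c s) (c t) = \<bar>s - t\<bar>"
    and p: "\<And>t. W t \<in> c t" "(W \<longlongrightarrow> p) at_bot" and q: "\<And>t. Z t \<in> c t" "(Z \<longlongrightarrow> q) at_top"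
    and z: "z \<in> c s"
  shows "2 * (norm (herm q z) * norm (herm p z)) = - qre (herm z z) * norm (herm q p)"
proof -
  have c: "c t \<in> hyp_space" for t using hyp by auto
  note lift = hyp_space_lift[OF c]
  have dist: "norm (herm u v) = cosh ((t - t') / 2) * sqrt (qre (herm u u) * qre (herm v v))"
    if "u \<in> c t" "v \<in> c t'" for u v t t'
  proof -
    have "rho (proj u) (proj v) = \<bar>t - t'\<bar>"
      using lift(2)[OF that(1)] lift(2)[OF that(2)] iso[of t t'] by (simp only:)
    then have "cosh (rho (proj u) (proj v) / 2) = cosh ((t - t') / 2)"
      by (cases "t \<ge> t'") (simp_all add: cosh_minus[of "(t - t') / 2", symmetric] diff_divide_distrib abs_if)
    then show ?thesis using norm_herm_rho[OF lift(1)[OF that(1)] lift(1)[OF that(2)]] by simp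
  qed
  have neg: "qre (herm u u) < 0" if "u \<in> c t" for u t
    using lift(1)[OF that] by (simp add: V_neg_def)
  \<comment> \<open>Both sides scale alike in the lifts, so their normalisation is irrelevant. The
    product formula for cosh makes the relation exact for each \<open>T\<close>, with a correction
    that vanishes in the limit.\<close>
  have eq: "2 * (norm (herm (Z T) z) * norm (herm (W (- T)) z))
    = (1 + cosh s / cosh T) * (- qre (herm z z) * norm (herm (Z T) (W (- T))))" for T
  proof -
    define a b e where "a = - qre (herm (Z T) (Z T))" and "b = - qre (herm (W (- T)) (W (- T)))"
      and "e = - qre (herm z z)"
    have pos: "a > 0" "b > 0" "e > 0"
      using neg[OF q(1)] neg[OF p(1)] neg[OF z] by (simp_all add: a_def b_def e_def)
    have 1: "norm (herm (Z T) z) = cosh ((T - s) / 2) * (sqrt a * sqrt e)"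
      using dist[OF q(1)[of T] z] by (simp add: a_def e_def flip: real_sqrt_mult)
    have 2: "norm (herm (W (- T)) z) = cosh ((T + s) / 2) * (sqrt b * sqrt e)"
    proof -
      have "cosh ((- T - s) / 2) = cosh ((T + s) / 2)"
        by (metis cosh_minus minus_add_distrib minus_divide_left uminus_add_conv_diff diff_conv_add_uminus)
      then show ?thesis
        using dist[OF p(1)[of "- T"] z] by (simp add: b_def e_def flip: real_sqrt_mult)
    qed
    have 3: "norm (herm (Z T) (W (- T))) = cosh T * (sqrt a * sqrt b)"
      using dist[OF q(1)[of T] p(1)[of "- T"]] by (simp add: a_def b_def flip: real_sqrt_mult)
    have "2 * (norm (herm (Z T) z) * norm (herm (W (- T)) z))
      = 2 * (cosh ((T - s) / 2) * cosh ((T + s) / 2)) * (sqrt a * sqrt b * (sqrt e * sqrt e))"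
      unfolding 1 2 by simp
    also have "\<dots> = (cosh T + cosh s) * (sqrt a * sqrt b * e)"
      unfolding cosh_half_mult using pos by simp
    also have "\<dots> = (1 + cosh s / cosh T) * (e * (cosh T * (sqrt a * sqrt b)))"
      by (simp add: field_simps)
    finally show ?thesis unfolding 3 e_def by simp
  qed
  have W: "((\<lambda>T. W (- T)) \<longlongrightarrow> p) at_top"
    using p(2) by (rule filterlim_compose[OF _ filterlim_uminus_at_bot_at_top])
  have "((\<lambda>T. 2 * (norm (herm (Z T) z) * norm (herm (W (- T)) z)))
    \<longlongrightarrow> 2 * (norm (herm q z) * norm (herm p z))) at_top"
    by (intro tendsto_intros tendsto_herm q W)
  moreover have "((\<lambda>T. (1 + cosh s / cosh T) * (- qre (herm z z) * norm (herm (Z T) (W (- T)))))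
    \<longlongrightarrow> (1 + 0) * (- qre (herm z z) * norm (herm q p))) at_top"
    by (intro tendsto_intros tendsto_herm q W inverse_cosh_tendsto)
  ultimately show ?thesis
    unfolding eq using tendsto_unique[OF trivial_limit_at_top_linorder] by fastforce
qed

lemma end_points_diag3:
  assumes "a \<noteq> 0" "b \<noteq> 0" "c \<noteq> 0"
  shows "{proj (axis 2 1), proj (axis 3 1)} \<subseteq> fixed_points (diag3 a b c)"
    and "proj (axis 2 1) \<noteq> proj (axis 3 1)"
proof -
  have n: "axis j 1 \<in> V_null" if "j = 2 \<or> j = 3" for j :: 3
    using that by (auto simp: V_null_def herm_def axis_def vec_eq_iff forall_3)
  have "diag3 a b c *v axis 2 1 = vscale (axis 2 1) b" "diag3 a b c *v axis 3 1 = vscale (axis 3 1) c"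
    by (simp_all add: vec_eq_iff forall_3 matrix_vector_mult_3 axis_def)
  then have "act (diag3 a b c) (proj (axis 2 1)) = proj (axis 2 1)"
    "act (diag3 a b c) (proj (axis 3 1)) = proj (axis 3 1)"
    using assms by (simp_all add: act_proj proj_vscale)
  then show "{proj (axis 2 1), proj (axis 3 1)} \<subseteq> fixed_points (diag3 a b c)"
    using n by (auto simp: fixed_points_def hyp_boundary_def)
  show "proj (axis 2 1) \<noteq> proj (axis 3 1)"
  proof
    assume "proj (axis 2 1) = proj (axis 3 1)"
    then have "axis 2 1 \<in> proj (axis 3 1)" using self_in_proj by blast
    then obtain q where "axis 2 1 = vscale (axis 3 1) q" by (auto simp: proj_eq)
    then have "axis 2 1 $ (2 :: 3) = vscale (axis 3 1) q $ 2" by simp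
    then show False by (simp add: axis_def)
  qed
qed

text \<open>Here \<open>- qre (herm z z)\<close> is \<open>2 * k\<close> minus the square of
  \<open>norm (z$1)\<close>, with \<open>k\<close> at most \<open>norm (z$2) * norm (z$3)\<close>.
  Equality forces \<open>z$1 = 0\<close> and makes \<open>qcnj (z$2) * z$3\<close> a positive real,
  so \<open>z$2\<close> is a positive real multiple of \<open>z$3\<close>.\<close>

lemma axis_pointI:
  assumes z: "z \<in> V_neg" and eq: "2 * (norm (z$2) * norm (z$3)) = - qre (herm z z)"
  shows "\<exists>t>0. proj z = proj (axis_point t)"
proof -
  define k where "k = qre (qcnj (z$2) * z$3)"
  have h: "- qre (herm z z) = 2 * k - (norm (z$1))\<^sup>2"
    unfolding quat_norm_sq k_def by (simp add: herm_def quat_sel_mult power2_eq_square)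
  have k: "k \<le> norm (z$2) * norm (z$3)"
    unfolding k_def by (rule qre_le_norm_mult)
  have "(norm (z$1))\<^sup>2 = 0"
    using h k eq zero_le_power2[of "norm (z$1)"] by linarith
  then have z1: "z$1 = 0" and k2: "k = norm (z$2) * norm (z$3)"
    using h eq by auto
  have pos: "k > 0" using z h z1 by (simp add: V_neg_def)
  then have nz: "z$2 \<noteq> 0" "z$3 \<noteq> 0" using k2 by auto
  have "qcnj (z$2) * z$3 = of_real k"
    using qre_eq_norm[of "qcnj (z$2) * z$3"] k2 by (simp add: k_def norm_mult)
  then have "z$2 * (qcnj (z$2) * z$3) = z$2 * of_real k" by simp
  then have "of_real ((norm (z$2))\<^sup>2) * z$3 = z$2 * of_real k"
    by (simp only: mult_qcnj flip: mult.assoc)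
  then have *: "z$2 = of_real ((norm (z$2))\<^sup>2 / k) * z$3"
    using pos by (simp add: quat_eq_iff quat_sel_mult field_simps del: of_real_power of_real_divide)
  have "z = vscale (axis_point ((norm (z$2))\<^sup>2 / k)) (z$3)"
    unfolding vec_eq_iff forall_3 using z1 * by simp
  then have "proj z = proj (axis_point ((norm (z$2))\<^sup>2 / k))"
    using proj_vscale[OF nz(2)] by metis
  then show ?thesis using pos nz by (intro exI[of _ "(norm (z$2))\<^sup>2 / k"]) simp
qed

text \<open>The two fixed points are e2 and e3 in one of two orders, and for them
  \<open>geodesic_end_points\<close> becomes the equation in \<open>axis_pointI\<close>.\<close>

lemma axis_subset:
  assumes axis: "is_axis (diag3 a b c) \<gamma>" and nz: "a \<noteq> 0" "b \<noteq> 0" "c \<noteq> 0"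
  shows "\<gamma> \<noteq> {}" "\<gamma> \<subseteq> {proj (axis_point t) |t. t > 0}"
proof -
  obtain p q where fp: "fixed_points (diag3 a b c) = {p, q}" and "geodesic_joining p q \<gamma>"
    using axis by (auto simp: is_axis_def)
  then obtain d where d: "range d = \<gamma>" "\<gamma> \<subseteq> hyp_space" "\<And>s t. rho (d s) (d t) = \<bar>s - t\<bar>"
    and "proj_tendsto d p at_bot" "proj_tendsto d q at_top"
    unfolding geodesic_joining_def by auto
  then obtain W zp Z zq where W: "\<And>t. W t \<in> d t" "(W \<longlongrightarrow> zp) at_bot" and zp: "zp \<in> p"
    and Z: "\<And>t. Z t \<in> d t" "(Z \<longlongrightarrow> zq) at_top" and zq: "zq \<in> q"
    unfolding proj_tendsto_def by auto
  have pq: "p = proj (axis 2 1) \<and> q = proj (axis 3 1) \<or> p = proj (axis 3 1) \<and> q = proj (axis 2 1)"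
    using end_points_diag3[OF nz] unfolding fp by auto
  show "\<gamma> \<noteq> {}" using d(1) by auto
  show "\<gamma> \<subseteq> {proj (axis_point t) |t. t > 0}"
  proof
    fix x assume "x \<in> \<gamma>"
    then obtain s where s: "x = d s" using d(1) by auto
    have x: "x \<in> hyp_space" using \<open>x \<in> \<gamma>\<close> d(2) by auto
    define z where "z = Z s"
    have z: "z \<in> d s" unfolding z_def by (rule Z)
    note lift = hyp_space_lift[OF x, of z, unfolded s, OF z]
    have E: "2 * (norm (herm zq z) * norm (herm zp z)) = - qre (herm z z) * norm (herm zq zp)"
      using d by (intro geodesic_end_points[OF _ _ W Z z]) auto
    have ax: "norm (herm (vscale (axis 2 1) u) z) = norm u * norm (z$3)"
      "norm (herm (vscale (axis 3 1) u) z) = norm u * norm (z$2)"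
      "norm (herm (vscale (axis 2 1) u) (vscale (axis 3 1) v)) = norm u * norm v"
      "norm (herm (vscale (axis 3 1) u) (vscale (axis 2 1) v)) = norm u * norm v" for u v
      by (simp_all add: herm_def axis_def norm_mult mult.commute)
    obtain u v where uv: "u \<noteq> 0" "v \<noteq> 0"
      and "zp = vscale (axis 2 1) u \<and> zq = vscale (axis 3 1) v \<or> zp = vscale (axis 3 1) u \<and> zq = vscale (axis 2 1) v"
      using pq zp zq by (auto simp: proj_eq)
    then have "2 * (norm (z$2) * norm (z$3)) * (norm u * norm v) = - qre (herm z z) * (norm u * norm v)"
      using E by (elim disjE conjE) (simp_all only: ax mult_ac)
    moreover have "norm u * norm v \<noteq> 0"
      using uv by simp
    ultimately have "2 * (norm (z$2) * norm (z$3)) = - qre (herm z z)"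
      by (metis mult_right_cancel)
    with lift show "x \<in> {proj (axis_point t) |t. t > 0}"
      using axis_pointI[of z] s by auto
  qed
qed

text \<open>In the squared modulus of the Hermitian product of the two lifts, the mixed terms
  combine into squares and \<open>2 * t * s\<close>. The arithmetic-geometric mean inequality,
  pairing opposite corner entries, then removes \<open>t\<close> and \<open>s\<close>.\<close>

lemma cross_sum_le_cosh_rho:
  assumes A: "A \<in> Sp21_set" and t: "t > 0" and s: "s > 0"
  shows "(cross_x A)\<^sup>2 + (cross_y A)\<^sup>2 \<le> cosh (rho (proj (axis_point t)) (act A (proj (axis_point s))))"
proof -
  define p q u v where "p = A$3$2" and "q = A$2$3" and "u = A$3$3" and "v = A$2$2"
  define \<rho> where "\<rho> = rho (proj (axis_point t)) (act A (proj (axis_point s)))"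
  note V = axis_point_V_neg[OF t] axis_point_V_neg[OF s]
  have I: "qre (x * qcnj y) = x \<bullet> y" "qre (qcnj x * y) = x \<bullet> y" for x y
    by (simp_all add: inner_quat_def quat_sel_mult)
  note R = Sp21_row_relations[OF A, unfolded I] Sp21_column_relations(1,2)[OF A, unfolded I]
  have uv: "v \<bullet> u + q \<bullet> p = 1 + A$2$1 \<bullet> A$3$1"
    using arg_cong[OF Sp21_row_relations(3)[OF A], of qre] by (simp add: I p_def q_def u_def v_def)
  have herm: "norm (herm (axis_point t) (A *v axis_point s)) = norm ((t * s) *\<^sub>R p + t *\<^sub>R u + s *\<^sub>R v + q)"
  proof -
    have "herm (A *v axis_point s) (axis_point t) = - ((t * s) *\<^sub>R p + t *\<^sub>R u + s *\<^sub>R v + q)"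
      unfolding quat_eq_iff
      by (simp add: herm_def matrix_vector_mult_3 quat_sel_mult p_def q_def u_def v_def algebra_simps)
    then show ?thesis by (metis norm_herm_swap norm_minus_cancel)
  qed
  have "(norm ((t * s) *\<^sub>R p + t *\<^sub>R u + s *\<^sub>R v + q))\<^sup>2
    = t\<^sup>2 * s\<^sup>2 * (norm p)\<^sup>2 + t\<^sup>2 * (norm u)\<^sup>2 + s\<^sup>2 * (norm v)\<^sup>2 + (norm q)\<^sup>2
      + t\<^sup>2 * s * (2 * (p \<bullet> u)) + t * s\<^sup>2 * (2 * (v \<bullet> p)) + t * (2 * (q \<bullet> u)) + s * (2 * (v \<bullet> q))
      + 2 * t * s * (v \<bullet> u + q \<bullet> p)"
    unfolding power2_norm_eq_inner
    by (simp add: inner_add_left inner_add_right inner_commute power2_eq_square algebra_simps)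
  \<comment> \<open>The row relations together with \<open>uv\<close> form the square containing
    \<open>A$3$1\<close> and \<open>A$2$1\<close>; the column relations form those of
    \<open>A$1$2\<close> and \<open>A$1$3\<close>.\<close>
  also have "\<dots> = t\<^sup>2 * s\<^sup>2 * (norm p)\<^sup>2 + t\<^sup>2 * (norm u)\<^sup>2 + s\<^sup>2 * (norm v)\<^sup>2 + (norm q)\<^sup>2
      + s * (norm (t *\<^sub>R A$3$1 + A$2$1))\<^sup>2 + t * s\<^sup>2 * (norm (A$1$2))\<^sup>2 + t * (norm (A$1$3))\<^sup>2 + 2 * t * s"
    unfolding uv R(1,2,4,5)[folded p_def q_def u_def v_def, symmetric]
    unfolding power2_norm_eq_inner
    by (simp add: inner_add_left inner_add_right inner_commute power2_eq_square algebra_simps)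
  finally have N: "(norm ((t * s) *\<^sub>R p + t *\<^sub>R u + s *\<^sub>R v + q))\<^sup>2
    \<ge> (t * s * norm p)\<^sup>2 + (t * norm u)\<^sup>2 + (s * norm v)\<^sup>2 + (norm q)\<^sup>2 + 2 * t * s"
    using s t by (simp add: power_mult_distrib)
  have sq: "2 * (x * y) \<le> x\<^sup>2 + y\<^sup>2" for x y :: real
    using sum_squares_bound[of x y] by (simp add: mult.assoc)
  have "2 * t * s * ((cross_x A)\<^sup>2 + (cross_y A)\<^sup>2 + 1)
    = 2 * ((t * s * norm p) * norm q) + 2 * ((t * norm u) * (s * norm v)) + 2 * t * s"
    unfolding cross_sq by (simp add: p_def q_def u_def v_def algebra_simps)
  also have "\<dots> \<le> (norm (herm (axis_point t) (A *v axis_point s)))\<^sup>2"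
    unfolding herm using N sq[of "t * s * norm p" "norm q"] sq[of "t * norm u" "s * norm v"] by linarith
  also have "\<dots> = 2 * t * s * (2 * (cosh (\<rho> / 2))\<^sup>2)"
    unfolding norm_herm_rho[OF V(1) Sp21_V_neg[OF A V(2)]] Sp21_herm[OF A] qre_herm_axis_point \<rho>_def act_proj
    using s t by (simp add: power_mult_distrib)
  finally have "(cross_x A)\<^sup>2 + (cross_y A)\<^sup>2 + 1 \<le> 2 * (cosh (\<rho> / 2))\<^sup>2"
    by (rule mult_left_le_imp_le) (use s t in simp)
  also have "2 * (cosh (\<rho> / 2))\<^sup>2 = cosh \<rho> + 1"
    using cosh_double_cosh[of "\<rho> / 2"] by simp
  finally show ?thesis by (simp add: \<rho>_def)
qed

lemma tubeD:
  assumes "x \<in> tube r \<gamma>" "\<gamma> \<noteq> {}"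
  shows "x \<in> hyp_space" "\<exists>y\<in>\<gamma>. rho x y < r"
  using assms cInf_lessD[of "rho x ` \<gamma>" r] by (auto simp: tube_def)

text \<open>A common point \<open>act A x\<close> of the two tubes is within \<open>r\<close> of
  some \<open>y'\<close> on the axis and of some \<open>act A y\<close> on its image, so these are
  less than \<open>2 * r\<close> apart.\<close>

lemma tube_meets:
  assumes A: "A \<in> Sp21_set" and \<gamma>: "\<gamma> \<noteq> {}" "\<gamma> \<subseteq> {proj (axis_point t) |t. t > 0}"
    and meet: "act A ` tube r \<gamma> \<inter> tube r \<gamma> \<noteq> {}"
  shows "(cross_x A)\<^sup>2 + (cross_y A)\<^sup>2 < cosh (2 * r)"
proof -
  obtain x where x: "x \<in> tube r \<gamma>" "act A x \<in> tube r \<gamma>" using meet by auto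
  obtain y y' where y: "y \<in> \<gamma>" "rho x y < r" and y': "y' \<in> \<gamma>" "rho (act A x) y' < r"
    using tubeD(2)[OF x(1) \<gamma>(1)] tubeD(2)[OF x(2) \<gamma>(1)] by auto
  obtain s t where s: "y = proj (axis_point s)" "s > 0" and t: "y' = proj (axis_point t)" "t > 0"
    using y(1) y'(1) \<gamma>(2) by blast
  obtain z where z: "x = proj z" "z \<in> V_neg"
    using tubeD(1)[OF x(1) \<gamma>(1)] by (auto simp: hyp_space_def)
  note V = axis_point_V_neg[OF s(2)] axis_point_V_neg[OF t(2)]
  have "rho y' (act A y) \<le> rho (act A x) y' + rho (act A x) (act A y)"
    unfolding s(1) t(1) z(1) act_proj by (intro rho_triangle Sp21_V_neg A V z)
  also have "\<dots> < 2 * r"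
    using y(2) y'(2) rho_act[OF A z(2) V(1)] by (simp add: s z(1))
  finally have "rho y' (act A y) < 2 * r" .
  moreover have "rho y' (act A y) \<ge> 0"
    unfolding s(1) t(1) act_proj by (intro rho_proj Sp21_V_neg A V)
  ultimately have "cosh (rho y' (act A y)) < cosh (2 * r)"
    by (simp add: cosh_real_nonneg_less_iff)
  then show ?thesis
    using cross_sum_le_cosh_rho[OF A t(2) s(2)] by (simp add: s t)
qed

section \<open>Small powers\<close>

lemma cos_ge_if_near:
  assumes "\<bar>x - of_int k\<bar> \<le> \<delta>" "\<delta> \<le> 1 / 2"
  shows "cos (2 * pi * x) \<ge> cos (2 * pi * \<delta>)"
proof -
  have "cos (2 * pi * x) = cos (2 * pi * (x - of_int k))"
    unfolding right_diff_distrib cos_diff by simp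
  also have "\<dots> = cos \<bar>2 * pi * (x - of_int k)\<bar>" by simp
  also have "\<bar>2 * pi * (x - of_int k)\<bar> = 2 * pi * \<bar>x - of_int k\<bar>" by (simp add: abs_mult)
  also have "cos \<dots> \<ge> cos (2 * pi * \<delta>)"
    using assms by (intro cos_monotone_0_pi_le) (auto simp: mult_left_mono)
  finally show ?thesis .
qed

text \<open>Pigeonhole principle for the fractional parts of \<open>(n \<alpha>, n \<beta>)\<close> in the \<open>K\<^sup>2\<close> boxes of side \<open>1 / K\<close>.\<close>
lemma simultaneous_dirichlet:
  fixes \<alpha> \<beta> :: real
  assumes K: "K \<ge> 2"
  obtains n :: nat where "1 \<le> n" "n \<le> K\<^sup>2"
    "cos (real n * \<alpha>) \<ge> cos (2 * pi / real K)" "cos (real n * \<beta>) \<ge> cos (2 * pi / real K)"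
proof -
  define box where "box \<theta> i = nat \<lfloor>real K * frac (real i * \<theta> / (2 * pi))\<rfloor>" for \<theta> and i :: nat
  have box_lt: "box \<theta> i < K" for \<theta> i
  proof -
    have "real K * frac (real i * \<theta> / (2 * pi)) < real K * 1"
      using K by (intro mult_strict_left_mono frac_lt_1) auto
    then have "\<lfloor>real K * frac (real i * \<theta> / (2 * pi))\<rfloor> < int K"
      by (simp add: floor_less_iff)
    then show ?thesis using K by (simp add: box_def nat_less_iff)
  qed
  \<comment> \<open>Equal boxes mean fractional parts at most \<open>1 / K\<close> apart, so the
    rotation by \<open>j - i\<close> steps is that close to a whole number of turns.\<close>
  have near: "cos (real (j - i) * \<theta>) \<ge> cos (2 * pi / real K)" if "i \<le> j" "box \<theta> i = box \<theta> j" for \<theta> i j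
  proof -
    let ?x = "\<lambda>i. real i * \<theta> / (2 * pi)"
    have "0 \<le> \<lfloor>real K * frac (?x i)\<rfloor>" "0 \<le> \<lfloor>real K * frac (?x j)\<rfloor>"
      by simp_all
    then have "\<lfloor>real K * frac (?x i)\<rfloor> = \<lfloor>real K * frac (?x j)\<rfloor>"
      using that(2) eq_nat_nat_iff unfolding box_def by blast
    then have "\<bar>real K * frac (?x j) - real K * frac (?x i)\<bar> \<le> 1"
      by linarith
    then have "real K * \<bar>frac (?x j) - frac (?x i)\<bar> \<le> 1"
      by (simp add: abs_mult flip: right_diff_distrib)
    then have "\<bar>frac (?x j) - frac (?x i)\<bar> \<le> 1 / real K"
      using K by (simp add: field_simps)
    moreover have "frac (?x j) - frac (?x i) = ?x (j - i) - of_int (\<lfloor>?x j\<rfloor> - \<lfloor>?x i\<rfloor>)"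
      using that(1) by (simp add: frac_def of_nat_diff diff_divide_distrib left_diff_distrib)
    ultimately have "\<bar>?x (j - i) - of_int (\<lfloor>?x j\<rfloor> - \<lfloor>?x i\<rfloor>)\<bar> \<le> 1 / real K"
      by (simp only:)
    moreover have "1 / real K \<le> 1 / 2"
      using K by (simp add: field_simps)
    ultimately have "cos (2 * pi * ?x (j - i)) \<ge> cos (2 * pi * (1 / real K))"
      by (rule cos_ge_if_near)
    then show ?thesis by simp
  qed
  \<comment> \<open>Including index 0 gives one index more than there are boxes and keeps the
    difference \<open>j - i\<close> at most \<open>K^2\<close>.\<close>
  have "card ((\<lambda>i. (box \<alpha> i, box \<beta> i)) ` {..K\<^sup>2}) \<le> card ({..<K} \<times> {..<K})"
    by (intro card_mono) (auto simp: box_lt)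
  also have "\<dots> < card {..K\<^sup>2}"
    by (simp add: power2_eq_square)
  finally have "\<not> inj_on (\<lambda>i. (box \<alpha> i, box \<beta> i)) {..K\<^sup>2}"
    by (rule pigeonhole)
  then obtain i j where "i \<le> K\<^sup>2" "j \<le> K\<^sup>2" "i \<noteq> j" "box \<alpha> i = box \<alpha> j" "box \<beta> i = box \<beta> j"
    unfolding inj_on_def by auto
  then obtain i j where ij: "i < j" "j \<le> K\<^sup>2" "box \<alpha> i = box \<alpha> j" "box \<beta> i = box \<beta> j"
    by (metis linorder_neqE_nat)
  show ?thesis
    by (rule that[of "j - i"]) (use ij near in auto)
qed

lemma norm_unit_minus_one:
  fixes x :: quat
  assumes "norm x = 1" "qre x \<ge> c"
  shows "norm (x - 1) \<le> sqrt (2 * (1 - c))"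
  using assms norm_diff_one_sq[of x] by (intro real_le_rsqrt) simp

text \<open>Let \<open>r\<close> be the cosine of the angle of \<open>x\<close>. The product of the
  two norms is \<open>2 * (cosh u - r)\<close> and their squares add up to
  \<open>4 * cosh u * (cosh u - r)\<close>, so the squared sum factors; it decreases in
  \<open>r\<close>.\<close>

lemma norm_minus_one_add_inverse:
  fixes x :: quat
  assumes x: "norm x = exp u" "qre x \<ge> exp u * c"
  shows "norm (x - 1) + norm (inverse (qcnj x) - 1) \<le> 2 * sqrt ((cosh u + 1) * (cosh u - c))"
proof -
  have "x \<noteq> 0" using x by auto
  have "inverse (qcnj x) = x /\<^sub>R (norm x)\<^sup>2"
    by (simp add: inverse_quat_def)
  then have q: "qre (inverse (qcnj x)) = qre x / (exp u)\<^sup>2"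
    by (simp add: x divide_inverse)
  have nq: "norm (inverse (qcnj x)) = exp (- u)"
    by (simp only: norm_inverse norm_qcnj x exp_minus)
  define r where "r = qre x / exp u"
  have r: "r \<ge> c" "qre x = r * exp u"
    using x(2) by (simp_all add: r_def field_simps)
  have r1: "r \<le> 1" using qre_le_norm[of x] by (simp add: x r)
  have eu: "exp u * exp (- u) = 1" by (simp add: exp_minus)
  have 1: "(norm (x - 1))\<^sup>2 = (exp u)\<^sup>2 + 1 - 2 * r * exp u"
    unfolding norm_diff_one_sq x r by simp
  have "qre x / (exp u)\<^sup>2 = r * exp (- u)"
    unfolding r(2) by (simp add: power2_eq_square exp_minus field_simps)
  then have 2: "(norm (inverse (qcnj x) - 1))\<^sup>2 = (exp (- u))\<^sup>2 + 1 - 2 * r * exp (- u)"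
    unfolding norm_diff_one_sq q nq by simp
  have cr: "0 \<le> cosh u - r" using r1 cosh_real_ge_1[of u] by linarith
  have "((norm (x - 1)) * (norm (inverse (qcnj x) - 1)))\<^sup>2 = (2 * (cosh u - r))\<^sup>2"
  proof -
    have "((exp u)\<^sup>2 + 1 - 2 * r * exp u) * ((exp (- u))\<^sup>2 + 1 - 2 * r * exp (- u)) = (exp u + exp (- u) - 2 * r)\<^sup>2"
      using eu by algebra
    also have "exp u + exp (- u) - 2 * r = 2 * (cosh u - r)"
      by (simp add: cosh_def field_simps)
    finally show ?thesis
      unfolding power_mult_distrib[of "norm (x - 1)"] 1 2 .
  qed
  then have prod: "norm (x - 1) * norm (inverse (qcnj x) - 1) = 2 * (cosh u - r)"
    by (rule power2_eq_imp_eq) (use cr in simp_all)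
  have "(norm (x - 1) + norm (inverse (qcnj x) - 1))\<^sup>2 = 4 * ((cosh u + 1) * (cosh u - r))"
  proof -
    have "(exp u)\<^sup>2 + (exp (- u))\<^sup>2 = 4 * (cosh u)\<^sup>2 - 2"
      using eu by (simp add: cosh_def power2_eq_square field_simps)
    moreover have "exp u + exp (- u) = 2 * cosh u" by (simp add: cosh_def)
    moreover have "(norm (x - 1))\<^sup>2 + (norm (inverse (qcnj x) - 1))\<^sup>2
      = ((exp u)\<^sup>2 + (exp (- u))\<^sup>2) + 2 - 2 * r * (exp u + exp (- u))"
      unfolding 1 2 by (simp add: algebra_simps)
    ultimately have "(norm (x - 1))\<^sup>2 + (norm (inverse (qcnj x) - 1))\<^sup>2 = 4 * (cosh u)\<^sup>2 - 4 * r * cosh u"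
      by simp
    then show ?thesis
      unfolding power2_sum mult.assoc prod by (simp add: power2_eq_square algebra_simps)
  qed
  also have "\<dots> \<le> 4 * ((cosh u + 1) * (cosh u - c))"
    using r(1) by (intro mult_left_mono) (auto simp: add_nonneg_nonneg cosh_real_nonneg)
  also have "\<dots> = (2 * sqrt ((cosh u + 1) * (cosh u - c)))\<^sup>2"
    using cr r(1) cosh_real_ge_1[of u] by (simp add: power_mult_distrib)
  finally show ?thesis
    by (rule power2_le_imp_le) (use cr r(1) in simp)
qed

theorem corollary1p6:
  fixes G :: "(quat^3^3) set" and g :: "quat^3^3" and \<gamma> :: "(quat^3) set set"
    and lam1 lam2 :: quat and l R r :: real
  assumes "subgroup G Sp21" and "discrete G" and "torsion_free G" and "\<not> elementary G"
    and "g \<in> G" and "loxodromic g" and "is_axis g \<gamma>"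
    and "primitive_in G g"
    and "g = diag3 lam1 lam2 (inverse (qcnj lam2))" and "norm lam1 = 1" and "norm lam2 > 1"
    and "l = 2 * ln (norm lam2)" and "l < 0.00017681"
    and "R = 2 * sqrt ((cosh (1849 * l / 2) + 1) * (cosh (1849 * l / 2) - cos (2 * pi / 43)))
           + 2 * sqrt (2 * (1 - cos (2 * pi / 43)))"
    and "r > 0" and "cosh (2 * r) = 2 * (1 - R) / R\<^sup>2"
  shows "precisely_invariant G (generate Sp21 {g}) (tube r \<gamma>)"
proof -
  interpret discrete_torsion_free G
    by (intro discrete_torsion_free.intro assms)
  define c43 where "c43 = cos (2 * pi / 43)"
  have "lam2 \<noteq> 0" using assms(11) by auto
  then have L2: "norm lam2 = exp (l / 2)" and l: "l > 0"
    using assms(11,12) by simp_all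
  obtain \<alpha> where \<alpha>: "\<And>n. qre (lam1 ^ n) = norm lam1 ^ n * cos (real n * \<alpha>)"
    by (rule qre_power[of lam1]) blast
  obtain \<beta> where \<beta>: "\<And>n. qre (lam2 ^ n) = norm lam2 ^ n * cos (real n * \<beta>)"
    by (rule qre_power[of lam2]) blast
  \<comment> \<open>There are 43 subdivisions per angle, and 1849 in the definition of
    \<open>R\<close> is the square of 43.\<close>
  obtain n :: nat where n: "1 \<le> n" "n \<le> 43\<^sup>2" "cos (real n * \<alpha>) \<ge> c43" "cos (real n * \<beta>) \<ge> c43"
    by (rule simultaneous_dirichlet[of 43 \<alpha> \<beta>]) (simp_all add: c43_def)
  define a b where "a = lam1 ^ n" and "b = lam2 ^ n"
  define u where "u = real n * l / 2"
  have u: "0 < u" "u \<le> 1849 * l / 2"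
    using n l by (simp_all add: u_def)
  have na: "norm a = 1" using assms(10) by (simp add: a_def norm_power)
  have nb: "norm b = exp u"
    by (simp add: b_def norm_power L2 u_def flip: exp_of_nat_mult)
  have qa: "qre a \<ge> c43" using \<alpha>[of n] n(3) assms(10) by (simp add: a_def)
  have qb: "qre b \<ge> exp u * c43"
    using \<beta>[of n] n(4) nb by (simp add: b_def norm_power)
  define M where "M = 2 * norm (a - 1) + norm (b - 1) + norm (inverse (qcnj b) - 1)"
  have f: "diag3 a b (inverse (qcnj b)) \<in> G"
  proof -
    have "inverse (qcnj lam2) ^ n = inverse (qcnj b)"
    proof -
      have "qcnj (lam2 ^ n) = qcnj lam2 ^ n"
        by (induction n) (simp_all add: power_commutes)
      then show ?thesis by (simp add: b_def power_inverse)
    qed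
    then have "diag3 a b (inverse (qcnj b)) = g [^]\<^bsub>Sp21\<^esub> n"
      unfolding assms(9) diag3_pow a_def b_def by simp
    then show ?thesis using pow_closed[OF assms(5)] by simp
  qed
  have "cosh u \<le> cosh (1849 * l / 2)"
    using u by (simp add: cosh_real_nonneg_le_iff)
  moreover have "c43 \<le> 1" by (simp add: c43_def)
  ultimately have "(cosh u + 1) * (cosh u - c43) \<le> (cosh (1849 * l / 2) + 1) * (cosh (1849 * l / 2) - c43)"
    using cosh_real_ge_1[of u] by (intro mult_mono) auto
  then have "2 * sqrt ((cosh u + 1) * (cosh u - c43)) \<le> 2 * sqrt ((cosh (1849 * l / 2) + 1) * (cosh (1849 * l / 2) - c43))"
    by simp
  then have MR: "M \<le> R"
    using norm_minus_one_add_inverse[OF nb qb] norm_unit_minus_one[OF na qa]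
    unfolding M_def assms(14) c43_def[symmetric] by linarith
  have "1 < norm b" using nb u by simp
  then have "0 < norm (b - 1)" by auto
  then have M0: "M > 0" unfolding M_def by (simp add: add_nonneg_pos add_pos_nonneg)
  have R0: "R > 0" using M0 MR by simp
  \<comment> \<open>Positivity of \<open>r\<close> makes \<open>R\<close> smaller than the positive
    root \<open>sqrt 3 - 1\<close> of \<open>R^2 + 2 * R = 2\<close>, which 0.7321 rounds
    up.\<close>
  have "1 < cosh (2 * r)"
    using cosh_real_nonneg_less_iff[of 0 "2 * r"] assms(15) by simp
  then have RR: "R\<^sup>2 < 2 * (1 - R)"
    using R0 unfolding assms(16) by simp
  have R1: "R < 0.7321"
  proof (rule ccontr)
    assume "\<not> R < 0.7321"
    then have "0.7321 * 0.7321 \<le> R * R" by (intro mult_mono) auto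
    then show False using RR \<open>\<not> R < 0.7321\<close> by (simp add: power2_eq_square)
  qed
  \<comment> \<open>The product of 1849/2 and 0.00017681 is just below 0.1635. A quadratic bound for
    exp then gives the condition \<open>M * L < 1\<close> of \<open>diag_if_cross_small\<close>,
    with \<open>L = exp u\<close>.\<close>
  have "u < 0.1635" using u assms(13) by simp
  moreover from this u(1) have "exp u \<le> 1 + u + u\<^sup>2" "u\<^sup>2 \<le> 0.1635\<^sup>2"
    by (intro exp_bound power_mono; simp)+
  ultimately have "exp u \<le> 1 + 0.1635 + 0.1635\<^sup>2"
    by linarith
  then have "M * exp u \<le> 0.7321 * (1 + 0.1635 + 0.1635\<^sup>2)"
    using MR R1 M0 by (intro mult_mono) auto
  then have LM: "M * exp u < 1" by (simp add: power2_eq_square)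
  \<comment> \<open>Replacing \<open>R\<close> by the smaller \<open>M\<close> increases the
    numerator and decreases the denominator.\<close>
  have "cosh (2 * r) \<le> 2 * (1 - M) / M\<^sup>2"
    unfolding assms(16) using M0 MR R1 by (intro frac_le mult_left_mono power_mono) auto
  have g: "g$2$3 = 0" "g$3$2 = 0" "norm (g$2$2) > 1"
    using assms(9,11) by simp_all
  have nz: "lam1 \<noteq> 0" "lam2 \<noteq> 0" "inverse (qcnj lam2) \<noteq> 0"
    using assms(10,11) by auto
  note axis = axis_subset[OF assms(7)[unfolded assms(9)] nz]
  show ?thesis
    unfolding precisely_invariant_def
  proof (rule ballI, rule ccontr)
    fix h assume h: "h \<in> G - generate Sp21 {g}" and meet: "act h ` tube r \<gamma> \<inter> tube r \<gamma> \<noteq> {}"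
    then have hG: "h \<in> G" by simp
    have "2 * (cross_x h * cross_y h) \<le> (cross_x h)\<^sup>2 + (cross_y h)\<^sup>2"
      using sum_squares_bound[of "cross_x h" "cross_y h"] by (simp add: mult.assoc)
    also have "\<dots> < cosh (2 * r)"
      by (rule tube_meets[OF in_Sp21[OF hG] axis meet])
    also note \<open>cosh (2 * r) \<le> 2 * (1 - M) / M\<^sup>2\<close>
    finally have "M * (cross_x h * cross_y h) < (1 - M) / M"
      using M0 by (simp add: power2_eq_square field_simps)
    moreover have "norm (inverse (qcnj b)) = inverse (exp u)" "1 < exp u"
      using u by (simp_all add: norm_inverse nb)
    ultimately have "h$2$3 = 0 \<and> h$3$2 = 0"
      by (intro diag_if_cross_small[OF f na nb _ _ M_def LM hG])
    then have "h \<in> generate Sp21 {g}"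
      using diag_subgroup_cyclic[OF assms(5) g assms(8) hG] by blast
    with h show False by simp
  qed
qed

end
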